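(* Let $\{(\mathcal C_n,\mathcal N_n)\}_{n\ge1}$ be a family of codes of dimension $K_n$ with encoding maps $\mathcal E_n$ and noise channels $\mathcal N_n$, and let $S_n=S(\Lambda_n+B_n\|\Lambda_n)$ be the corresponding AQEC relative entropies. Then: (1) If $\lim_{n\to\infty}S_n=0$, there exists a family of recovery channels $\{\mathcal R_n\}$ with $\lim_{n\to\infty}F_e(\mathcal R_n\circ\mathcal N_n\circ\mathcal E_n)=1$. (2) If $K_n=O(1)$ and $S_n$ does not converge to $0$, then for every family of recovery channels $\{\mathcal R_n\}$, $F_e(\mathcal R_n\circ\mathcal N_n\circ\mathcal E_n)$ does not converge to $1$. (3) If $K_n\to\infty$ and $s_n:=S_n/\log K_n$ does not converge to $0$, then for every family of recovery channels $\{\mathcal R_n\}$, $F_e(\mathcal R_n\circ\mathcal N_n\circ\mathcal E_n)$ does not converge to $1$.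
   Context: For each $n$: $\mathcal H_n$ is a finite-dimensional Hilbert space, $\mathcal C_n\subseteq\mathcal H_n$ a code subspace of dimension $K_n$ with orthonormal basis $\{|q\rangle\}$, encoding $\mathcal E_n(\rho)=V_n\rho V_n^\dagger$ with $V_n:\mathbb C^{K_n}\to\mathcal H_n$ the isometry onto $\mathcal C_n$ sending the standard basis to $\{|q\rangle\}$, and $\mathcal N_n(\rho)=\sum_u E_u\rho E_u^\dagger$ a CPTP noise channel. With $P$ the projector onto $\mathcal C_n$, write $PE_u^\dagger E_vP=\lambda_{uv}P+PB_{uv}P$ where $\lambda_{uv}=\frac1{K_n}\mathrm{tr}(PE_u^\dagger E_vP)$; define matrices with rows indexed by $(u,q_1)$ and columns by $(v,q_2)$: $(\Lambda_n)_{uv,q_1q_2}=\lambda_{uv}\delta_{q_1q_2}/K_n$, $(B_n)_{uv,q_1q_2}=\langle q_1|B_{uv}|q_2\rangle/K_n$. The AQEC relative entropy is $S(\Lambda+B\|\Lambda)=\mathrm{tr}\{(\Lambda+B)[\log(\Lambda+B)-\log\Lambda]\}$. A recovery channel $\mathcal R_n$ is a CPTP map from operators on $\mathcal H_n$ to operators on $\mathbb C^{K_n}$. $F_e(\Phi)=\sum_i|\mathrm{tr}(A_i)/K|^2$ is the entanglement fidelity of a channel $\Phi$ on $\mathbb C^K$ with Kraus operators $\{A_i\}$, relative to the maximally mixed state $I_K/K$. *)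

theory Defs
  imports "Jordan_Normal_Form.Matrix" "Jordan_Normal_Form.Conjugate" Complex_Main
begin

definition adj :: "complex mat \<Rightarrow> complex mat" where
  "adj A = mat (dim_col A) (dim_row A) (\<lambda>(i,j). cnj (A $$ (j,i)))"

definition tr :: "complex mat \<Rightarrow> complex" where
  "tr A = (\<Sum>i<dim_row A. A $$ (i,i))"

definition hermitian :: "complex mat \<Rightarrow> bool" where
  "hermitian A \<longleftrightarrow> square_mat A \<and> adj A = A"

definition unitary :: "complex mat \<Rightarrow> bool" where
  "unitary U \<longleftrightarrow> square_mat U \<and> adj U * U = 1\<^sub>m (dim_row U) \<and> U * adj U = 1\<^sub>m (dim_row U)"

text \<open>Functional calculus for Hermitian matrices via a spectral decomposition
  A = U D U^dagger (U unitary, D real diagonal): f(A) = U f(D) U^dagger.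
  The result does not depend on the chosen decomposition.\<close>
definition mat_fun :: "(real \<Rightarrow> real) \<Rightarrow> complex mat \<Rightarrow> complex mat" where
  "mat_fun f A = (SOME M. \<exists>U d. U \<in> carrier_mat (dim_row A) (dim_row A) \<and> unitary U \<and>
      A = U * mat (dim_row A) (dim_row A) (\<lambda>(i,j). if i = j then complex_of_real (d i) else 0) * adj U \<and>
      M = U * mat (dim_row A) (dim_row A) (\<lambda>(i,j). if i = j then complex_of_real (f (d i)) else 0) * adj U)"

text \<open>Matrix logarithm (natural log). On the kernel, Isabelle's convention ln 0 = 0 makes this
  the logarithm on the support, which is the standard convention for relative entropy when the
  support of the first argument lies in that of the second.\<close>
definition mat_log :: "complex mat \<Rightarrow> complex mat" where
  "mat_log A = mat_fun ln A"

definition rel_entropy :: "complex mat \<Rightarrow> complex mat \<Rightarrow> real" where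
  "rel_entropy R S = Re (tr (R * (mat_log R - mat_log S)))"

text \<open>A CPTP map from operators on C^din to operators on C^dout, given by a (finite) list of
  Kraus operators (every CPTP map between finite-dimensional spaces has such a representation).\<close>
definition kraus_channel :: "complex mat list \<Rightarrow> nat \<Rightarrow> nat \<Rightarrow> bool" where
  "kraus_channel As din dout \<longleftrightarrow>
     (\<forall>A\<in>set As. A \<in> carrier_mat dout din) \<and>
     foldr (\<lambda>A M. adj A * A + M) As (0\<^sub>m din din) = 1\<^sub>m din"

definition isometry :: "complex mat \<Rightarrow> nat \<Rightarrow> nat \<Rightarrow> bool" where
  "isometry V k d \<longleftrightarrow> V \<in> carrier_mat d k \<and> adj V * V = 1\<^sub>m k"

definition kraus_comp :: "complex mat list \<Rightarrow> complex mat list \<Rightarrow> complex mat list" where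
  "kraus_comp Bs As = [B * A. B \<leftarrow> Bs, A \<leftarrow> As]"

text \<open>Entanglement fidelity relative to the maximally mixed state on C^K.\<close>
definition ent_fidelity :: "nat \<Rightarrow> complex mat list \<Rightarrow> real" where
  "ent_fidelity K As = (\<Sum>A\<leftarrow>As. (cmod (tr A / of_nat K))^2)"

text \<open>Code given by the isometry V (d x K, columns = code basis |q>), noise Kraus list Es
  (index u = position in the list, m = length Es). Rows/columns (u,q) are encoded as u*K+q.\<close>

definition code_proj :: "complex mat \<Rightarrow> complex mat" where
  "code_proj V = V * adj V"

definition aqec_lambda :: "complex mat \<Rightarrow> nat \<Rightarrow> complex mat list \<Rightarrow> nat \<Rightarrow> nat \<Rightarrow> complex" where
  "aqec_lambda V K Es u v =
     tr (code_proj V * adj (Es ! u) * (Es ! v) * code_proj V) / of_nat K"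

definition Lambda_mat :: "complex mat \<Rightarrow> nat \<Rightarrow> complex mat list \<Rightarrow> complex mat" where
  "Lambda_mat V K Es = mat (length Es * K) (length Es * K) (\<lambda>(i,j).
      let u = i div K; q1 = i mod K; v = j div K; q2 = j mod K in
      (if q1 = q2 then aqec_lambda V K Es u v else 0) / of_nat K)"

definition B_mat :: "complex mat \<Rightarrow> nat \<Rightarrow> complex mat list \<Rightarrow> complex mat" where
  "B_mat V K Es = mat (length Es * K) (length Es * K) (\<lambda>(i,j).
      let u = i div K; q1 = i mod K; v = j div K; q2 = j mod K in
      ((adj V * code_proj V * adj (Es ! u) * (Es ! v) * code_proj V * V) $$ (q1, q2)
        - (if q1 = q2 then aqec_lambda V K Es u v else 0)) / of_nat K)"

definition aqec_entropy :: "complex mat \<Rightarrow> nat \<Rightarrow> complex mat list \<Rightarrow> real" where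
  "aqec_entropy V K Es = rel_entropy (Lambda_mat V K Es + B_mat V K Es) (Lambda_mat V K Es)"

end

theory Submission
  imports Defs "HOL-Analysis.Convex"
    "Jordan_Normal_Form.Schur_Decomposition" "Jordan_Normal_Form.Spectral_Radius"
begin

text \<open>With \<open>X\<close> the matrix of the blocks \<open>E_u V / sqrt K\<close>, the matrix \<open>\<rho> = \<Lambda> + B\<close> equals \<open>X\<^sup>\<dagger> X\<close>, the joint
  state of environment and reference, and \<open>\<sigma> = \<Lambda>\<close> equals \<open>tr\<^sub>R \<rho> \<otimes> I / K\<close>. In terms of eigenvalues \<open>p\<close>, \<open>s\<close>
  and the overlaps \<open>x\<close> of the eigenvectors, \<open>S = (\<Sum>i j. p i * |x j i|\<^sup>2 * (ln (p i) - ln (s j)))\<close>.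

  For (1), \<open>ln t \<le> t - 1\<close> gives \<open>S \<ge> 2 (1 - tr (\<rho>\<^bsup>1/2\<^esup> \<sigma>\<^bsup>1/2\<^esup>))\<close>. Recovering with the adjoint of the partial isometry
  in the polar decomposition of \<open>X\<close>, Cauchy-Schwarz yields \<open>F\<^sub>e \<ge> (tr (\<rho>\<^bsup>1/2\<^esup> \<sigma>\<^bsup>1/2\<^esup>))\<^sup>2\<close>.

  For (2) and (3), append the recovery to \<open>X\<close>, which leaves \<open>X\<^sup>\<dagger> X\<close> unchanged, and split each block of \<open>X\<close> into
  its scalar part \<open>H\<close> and its traceless part \<open>Z\<close>. The squared Frobenius norms are \<open>F\<^sub>e\<close> and \<open>1 - F\<^sub>e\<close>, and
  \<open>H\<^sup>\<dagger> H \<le> \<sigma>\<close>, \<open>Z\<^sup>\<dagger> Z \<le> K\<^sup>2 \<sigma>\<close>. Bounding the logarithm by a power \<open>\<theta>\<close> and interpolating between these estimates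
  gives \<open>S \<le> (2 \<eta> + \<eta>\<^sup>2) / \<theta>\<close> with \<open>\<eta> = K\<^bsup>\<theta>\<^esup> (1 - F\<^sub>e)\<^bsup>(1 - \<theta>)/2\<^esup>\<close>, independently of the number of Kraus operators.
  Take \<open>\<theta> = 1/2\<close> for bounded \<open>K\<close>, and \<open>\<theta> = 1 / ln K\<close>, for which \<open>K\<^bsup>\<theta>\<^esup> = e\<close>, for unbounded \<open>K\<close>.\<close>

section \<open>Adjoint, trace and Frobenius norm\<close>

lemma index_mult_mat_sum:
  assumes "i < dim_row A" "j < dim_col B" "dim_col A = dim_row B"
  shows "(A * B) $$ (i, j) = (\<Sum>k<dim_row B. A $$ (i, k) * B $$ (k, j))"
  using assms by (auto simp: scalar_prod_def lessThan_atLeast0 intro!: sum.cong)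

lemma mult_mat_assoc:
  assumes "dim_col A = dim_row B" "dim_col B = dim_row C"
  shows "(A * B) * C = A * (B * (C :: complex mat))"
  using assms by (intro assoc_mult_mat[of A "dim_row A" "dim_row B" B "dim_row C" C "dim_col C"]) auto

lemma adj_dim [simp]: "dim_row (adj A) = dim_col A" "dim_col (adj A) = dim_row A"
  by (simp_all add: adj_def)

lemma adj_carrier [simp]: "A \<in> carrier_mat n m \<Longrightarrow> adj A \<in> carrier_mat m n"
  by auto

lemma adj_index [simp]:
  "i < dim_col A \<Longrightarrow> j < dim_row A \<Longrightarrow> adj A $$ (i, j) = cnj (A $$ (j, i))"
  by (simp add: adj_def)

lemma adj_adj [simp]: "adj (adj A) = A"
  by (rule eq_matI) auto

lemma adj_mult:
  assumes "dim_col A = dim_row B"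
  shows "adj (A * B) = adj B * adj A"
proof (rule eq_matI)
  fix i j assume "i < dim_row (adj B * adj A)" "j < dim_col (adj B * adj A)"
  then have ij: "i < dim_col B" "j < dim_row A" by auto
  have "adj (A * B) $$ (i, j) = cnj ((A * B) $$ (j, i))" using ij by simp
  also have "\<dots> = (\<Sum>k<dim_row B. cnj (A $$ (j, k)) * cnj (B $$ (k, i)))"
    using ij assms by (subst index_mult_mat_sum) auto
  also have "\<dots> = (adj B * adj A) $$ (i, j)"
    using ij assms by (subst index_mult_mat_sum) (auto intro!: sum.cong)
  finally show "adj (A * B) $$ (i, j) = (adj B * adj A) $$ (i, j)" .
qed auto

lemma adj_add:
  "dim_row A = dim_row B \<Longrightarrow> dim_col A = dim_col B \<Longrightarrow> adj (A + B) = adj A + adj B"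
  by (rule eq_matI) auto

lemma adj_four_block_mat:
  assumes "A \<in> carrier_mat n1 m1" "B \<in> carrier_mat n1 m2" "C \<in> carrier_mat n2 m1" "D \<in> carrier_mat n2 m2"
  shows "adj (four_block_mat A B C D) = four_block_mat (adj A) (adj C) (adj B) (adj D)"
  using assms by (intro eq_matI) (auto simp: not_less)

lemma tr_mult_comm:
  assumes "dim_col A = dim_row B" "dim_col B = dim_row A"
  shows "tr (A * B) = tr (B * A)"
proof -
  have "tr (A * B) = (\<Sum>i<dim_row A. \<Sum>k<dim_row B. A $$ (i, k) * B $$ (k, i))"
    using assms unfolding tr_def by (auto intro!: sum.cong simp: index_mult_mat_sum simp del: index_mult_mat(1))
  also have "\<dots> = (\<Sum>k<dim_row B. \<Sum>i<dim_row A. B $$ (k, i) * A $$ (i, k))"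
    by (subst sum.swap) (simp add: mult.commute)
  also have "\<dots> = tr (B * A)"
    using assms unfolding tr_def by (auto intro!: sum.cong simp: index_mult_mat_sum simp del: index_mult_mat(1))
  finally show ?thesis .
qed

definition frob :: "complex mat \<Rightarrow> real" where
  "frob A = (\<Sum>i<dim_row A. \<Sum>j<dim_col A. (cmod (A $$ (i, j)))\<^sup>2)"

lemma frob_nonneg [simp]: "frob A \<ge> 0"
  unfolding frob_def by (intro sum_nonneg) auto

lemma frob_adj [simp]: "frob (adj A) = frob A"
  unfolding frob_def by (subst sum.swap) (auto intro!: sum.cong)

lemma tr_adj_mult_self: "tr (adj A * A) = of_real (frob A)"
proof -
  have "tr (adj A * A) = (\<Sum>j<dim_col A. \<Sum>i<dim_row A. cnj (A $$ (i, j)) * A $$ (i, j))"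
    unfolding tr_def by (auto intro!: sum.cong simp: index_mult_mat_sum simp del: index_mult_mat(1))
  also have "\<dots> = (\<Sum>i<dim_row A. \<Sum>j<dim_col A. of_real ((cmod (A $$ (i, j)))\<^sup>2))"
    by (subst sum.swap) (simp add: complex_norm_square mult.commute del: of_real_power)
  finally show ?thesis by (simp add: frob_def)
qed

lemma frob_isometry_mult:
  assumes "adj P * P = 1\<^sub>m (dim_col P)" "dim_col P = dim_row A"
  shows "frob (P * A) = frob A"
proof -
  have "of_real (frob (P * A)) = tr (adj A * ((adj P * P) * A))"
    using assms(2) by (simp add: tr_adj_mult_self [symmetric] adj_mult mult_mat_assoc)
  also have "\<dots> = of_real (frob A)"
    using assms by (simp add: tr_adj_mult_self left_mult_one_mat[of A "dim_row A" "dim_col A"])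
  finally show ?thesis by (simp only: of_real_eq_iff)
qed

lemma tr_diff: "dim_row A = dim_row B \<Longrightarrow> dim_col B = dim_row B \<Longrightarrow> tr (A - B) = tr A - tr B"
  by (simp add: tr_def sum_subtractf)

section \<open>The spectral theorem and functional calculus\<close>

definition rdiag :: "nat \<Rightarrow> (nat \<Rightarrow> real) \<Rightarrow> complex mat" where
  "rdiag n d = mat n n (\<lambda>(i, j). if i = j then complex_of_real (d i) else 0)"

lemma rdiag_dim [simp]: "dim_row (rdiag n d) = n" "dim_col (rdiag n d) = n"
  by (simp_all add: rdiag_def)

lemma rdiag_carrier [simp]: "rdiag n d \<in> carrier_mat n n"
  by auto

lemma rdiag_index [simp]:
  "i < n \<Longrightarrow> j < n \<Longrightarrow> rdiag n d $$ (i, j) = (if i = j then complex_of_real (d i) else 0)"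
  by (simp add: rdiag_def)

lemma adj_rdiag [simp]: "adj (rdiag n d) = rdiag n d"
  by (rule eq_matI) auto

lemma index_mult_rdiag:
  assumes "i < dim_row A" "j < n" "dim_col A = n"
  shows "(A * rdiag n d) $$ (i, j) = A $$ (i, j) * complex_of_real (d j)"
proof -
  have "(A * rdiag n d) $$ (i, j) = (\<Sum>k<n. if k = j then A $$ (i, j) * complex_of_real (d j) else 0)"
    using assms by (subst index_mult_mat_sum) (auto intro!: sum.cong simp del: sum.delta sum.delta')
  then show ?thesis using assms by simp
qed

lemma index_rdiag_mult:
  assumes "i < n" "j < dim_col A" "dim_row A = n"
  shows "(rdiag n d * A) $$ (i, j) = complex_of_real (d i) * A $$ (i, j)"
proof -
  have "(rdiag n d * A) $$ (i, j) = (\<Sum>k<n. if k = i then complex_of_real (d i) * A $$ (i, j) else 0)"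
    using assms by (subst index_mult_mat_sum) (auto intro!: sum.cong simp del: sum.delta sum.delta')
  then show ?thesis using assms by simp
qed

lemma rdiag_mult: "rdiag n f * rdiag n g = rdiag n (\<lambda>i. f i * g i)"
  by (rule eq_matI) (auto simp: index_mult_rdiag simp del: index_mult_mat(1))

lemma unitary_iff:
  assumes "U \<in> carrier_mat n n"
  shows "unitary U \<longleftrightarrow> adj U * U = 1\<^sub>m n"
  using assms mat_mult_left_right_inverse[of "adj U" n U] by (auto simp: unitary_def)

text \<open>One deflation step for the spectral theorem. An eigenvector exists over the complex
  numbers; completing it to a basis and orthogonalizing keeps it as the first vector.\<close>

lemma unitary_with_first_column_eigenvector:
  fixes A :: "complex mat"
  assumes A: "A \<in> carrier_mat n n" and n: "n \<noteq> 0"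
  obtains W e where "W \<in> carrier_mat n n" "adj W * W = 1\<^sub>m n"
    "\<And>i. i < n \<Longrightarrow> (A * W) $$ (i, 0) = e * W $$ (i, 0)"
proof -
  obtain e where "e \<in> spectrum A" using spectrum_non_empty[OF A] n by blast
  then have e: "eigenvalue A e" by (simp add: spectrum_def)
  define v where "v = find_eigenvector A e"
  define b where "b = basis_completion v"
  define ws where "ws = gram_schmidt n b"
  from find_eigenvector[OF A e] have ev: "eigenvector A v e" unfolding v_def .
  from this[unfolded eigenvector_def]
  have v: "v \<in> carrier_vec n" and v0: "v \<noteq> 0\<^sub>v n" and Av: "A *\<^sub>v v = e \<cdot>\<^sub>v v" using A by auto
  interpret cof_vec_space n "TYPE(complex)" .
  from basis_completion[OF v v0, folded b_def]
  have span_b: "span (set b) = carrier_vec n" and dist_b: "distinct b"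
    and indep: "\<not> lin_dep (set b)" and b: "set b \<subseteq> carrier_vec n" and hdb: "hd b = v"
    and len_b: "length b = n" by auto
  from hdb len_b n obtain vs where bv: "b = v # vs" by (cases b) auto
  from gram_schmidt_result[OF b dist_b indep refl, folded ws_def]
  have ws: "set ws \<subseteq> carrier_vec n" "corthogonal ws" "length ws = n" by (auto simp: len_b)
  from gram_schmidt_hd[OF v, of vs, folded bv] have "hd ws = v" unfolding ws_def .
  then have ws0: "ws ! 0 = v" using ws(3) n by (cases ws) auto
  \<comment> \<open>\<open>gram_schmidt\<close> gives orthogonal vectors that need not be unit
    vectors; dividing by the lengths \<open>sqrt (N j)\<close> makes the columns
    orthonormal.\<close>
  define N where "N j = (\<Sum>k<n. (cmod (ws ! j $ k))\<^sup>2)" for j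
  define W where "W = mat n n (\<lambda>(i, j). ws ! j $ i / of_real (sqrt (N j)))"
  have W: "W \<in> carrier_mat n n" by (simp add: W_def)
  have wsc: "ws ! j \<in> carrier_vec n" if "j < n" for j using ws that by auto
  have ip: "ws ! j \<bullet>c ws ! i = (\<Sum>k<n. ws ! j $ k * cnj (ws ! i $ k))" if "i < n" "j < n" for i j
    using wsc[OF that(1)] wsc[OF that(2)] by (auto simp: scalar_prod_def lessThan_atLeast0)
  have ortho: "(\<Sum>k<n. ws ! j $ k * cnj (ws ! i $ k)) = 0 \<longleftrightarrow> i \<noteq> j" if "i < n" "j < n" for i j
    using corthogonalD[OF ws(2)] ip[OF that] that ws(3) by metis
  have Nj: "(\<Sum>k<n. ws ! j $ k * cnj (ws ! j $ k)) = of_real (N j)" for j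
    by (simp add: N_def complex_norm_square del: of_real_power)
  have Npos: "N j > 0" if "j < n" for j
  proof -
    have "N j \<ge> 0" unfolding N_def by (intro sum_nonneg) auto
    moreover have "N j \<noteq> 0" using ortho[OF that that] Nj[of j] by auto
    ultimately show ?thesis by simp
  qed
  have "adj W * W = 1\<^sub>m n"
  proof (rule eq_matI)
    fix i j assume "i < dim_row (1\<^sub>m n :: complex mat)" "j < dim_col (1\<^sub>m n :: complex mat)"
    then have ij: "i < n" "j < n" by auto
    have "(adj W * W) $$ (i, j) = (\<Sum>k<n. cnj (W $$ (k, i)) * W $$ (k, j))"
      using ij W by (subst index_mult_mat_sum) auto
    also have "\<dots> = (\<Sum>k<n. ws ! j $ k * cnj (ws ! i $ k)) / (of_real (sqrt (N i)) * of_real (sqrt (N j)))"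
      unfolding sum_divide_distrib using ij by (intro sum.cong) (auto simp: W_def)
    also have "\<dots> = 1\<^sub>m n $$ (i, j)"
    proof (cases "i = j")
      case True
      then show ?thesis using Npos[OF ij(1)] ij
        by (simp add: Nj flip: of_real_mult)
    next
      case False
      then show ?thesis using ortho[OF ij] ij by simp
    qed
    finally show "(adj W * W) $$ (i, j) = 1\<^sub>m n $$ (i, j)" .
  qed (use W in auto)
  moreover have "(A * W) $$ (i, 0) = e * W $$ (i, 0)" if i: "i < n" for i
  proof -
    have "(A * W) $$ (i, 0) = (\<Sum>k<n. A $$ (i, k) * W $$ (k, 0))"
      using i n A W by (subst index_mult_mat_sum) auto
    also have "\<dots> = (\<Sum>k<n. A $$ (i, k) * v $ k) / of_real (sqrt (N 0))"
      unfolding sum_divide_distrib using n by (intro sum.cong) (auto simp: W_def ws0)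
    also have "(\<Sum>k<n. A $$ (i, k) * v $ k) = (A *\<^sub>v v) $ i"
      using A v i by (auto simp: scalar_prod_def lessThan_atLeast0)
    also have "\<dots> = e * v $ i" using Av v i by simp
    finally show ?thesis using i n by (simp add: W_def ws0)
  qed
  ultimately show ?thesis using W that by blast
qed

lemma hermitian_conj:
  assumes "A \<in> carrier_mat n n" "adj A = A" "W \<in> carrier_mat n m"
  shows "adj (adj W * A * W) = adj W * A * W"
  using assms by (simp add: adj_mult mult_mat_assoc carrier_matD)

text \<open>Induction by deflation: conjugating with \<open>W\<close> leaves only the eigenvalue in
  the first column, symmetry then clears the first row, and the induction hypothesis diagonalizes
  the remaining block \<open>A3\<close>.\<close>

theorem hermitian_spectral:
  assumes "A \<in> carrier_mat n n" "adj A = A"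
  shows "\<exists>U d. U \<in> carrier_mat n n \<and> unitary U \<and> A = U * rdiag n d * adj U"
  using assms
proof (induction n arbitrary: A)
  case 0
  then show ?case
    by (intro exI[of _ "1\<^sub>m 0"] exI[of _ "\<lambda>_. 0"]) (auto simp: unitary_def)
next
  case (Suc n)
  obtain W e where W: "W \<in> carrier_mat (Suc n) (Suc n)" and WW: "adj W * W = 1\<^sub>m (Suc n)"
    and We: "\<And>i. i < Suc n \<Longrightarrow> (A * W) $$ (i, 0) = e * W $$ (i, 0)"
    using unitary_with_first_column_eigenvector[OF Suc.prems(1)] by blast
  have WW': "W * adj W = 1\<^sub>m (Suc n)"
    using mat_mult_left_right_inverse[OF _ W WW] W by simp
  define M where "M = adj W * A * W"
  have Mc: "M \<in> carrier_mat (Suc n) (Suc n)" using W Suc.prems by (auto simp: M_def)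
  have Mh: "adj M = M" unfolding M_def by (rule hermitian_conj[OF Suc.prems W])
  have M0: "M $$ (i, 0) = (if i = 0 then e else 0)" if i: "i < Suc n" for i
  proof -
    have "M = adj W * (A * W)" using W Suc.prems by (simp add: M_def mult_mat_assoc)
    then have "M $$ (i, 0) = (\<Sum>k<Suc n. cnj (W $$ (k, i)) * (A * W) $$ (k, 0))"
      using W Suc.prems i by (simp add: index_mult_mat_sum del: index_mult_mat(1) sum.lessThan_Suc)
    also have "\<dots> = e * (\<Sum>k<Suc n. cnj (W $$ (k, i)) * W $$ (k, 0))"
      unfolding sum_distrib_left using We by (intro sum.cong) auto
    also have "(\<Sum>k<Suc n. cnj (W $$ (k, i)) * W $$ (k, 0)) = (adj W * W) $$ (i, 0)"
      using W i by (simp add: index_mult_mat_sum del: index_mult_mat(1) sum.lessThan_Suc)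
    finally show ?thesis using i by (simp add: WW)
  qed
  have Mcnj: "M $$ (i, j) = cnj (M $$ (j, i))" if "i < Suc n" "j < Suc n" for i j
    using Mc that by (subst Mh[symmetric]) simp
  have er: "e = of_real (Re e)"
    using Mcnj[of 0 0] M0[of 0] by (simp add: complex_eq_iff)
  define A3 where "A3 = mat n n (\<lambda>(i, j). M $$ (Suc i, Suc j))"
  have "adj A3 = A3"
    by (rule eq_matI) (auto simp: A3_def intro: Mcnj[symmetric])
  then obtain U3 d3 where U3: "U3 \<in> carrier_mat n n" "unitary U3" "A3 = U3 * rdiag n d3 * adj U3"
    using Suc.IH[of A3] by (auto simp: A3_def)
  have U3u: "adj U3 * U3 = 1\<^sub>m n" using U3 by (auto simp: unitary_def)
  define d where "d i = (case i of 0 \<Rightarrow> Re e | Suc j \<Rightarrow> d3 j)" for i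
  define F where "F = four_block_mat (1\<^sub>m 1) (0\<^sub>m 1 n) (0\<^sub>m n 1) U3"
  have Fc: "F \<in> carrier_mat (Suc n) (Suc n)" using U3 by (auto simp: F_def)
  have [simp]: "adj (1\<^sub>m k) = 1\<^sub>m k" "adj (0\<^sub>m k l) = 0\<^sub>m l k" for k l
    by (auto intro!: eq_matI)
  have Fadj: "adj F = four_block_mat (1\<^sub>m 1) (0\<^sub>m 1 n) (0\<^sub>m n 1) (adj U3)"
    unfolding F_def by (subst adj_four_block_mat[where ?n1.0=1 and ?m1.0=1 and ?n2.0=n and ?m2.0=n]) (use U3 in auto)
  have FF: "adj F * F = 1\<^sub>m (Suc n)"
    unfolding Fadj unfolding F_def
    by (subst mult_four_block_mat[where ?nr1.0=1 and ?n1.0=1 and ?nr2.0=n and ?n2.0=n and ?nc1.0=1 and ?nc2.0=n])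
      (use U3 U3u in \<open>auto intro!: eq_matI\<close>)
  have Dd: "rdiag (Suc n) d = four_block_mat (e \<cdot>\<^sub>m 1\<^sub>m 1) (0\<^sub>m 1 n) (0\<^sub>m n 1) (rdiag n d3)"
    using er by (intro eq_matI) (auto simp: d_def split: nat.splits)
  have "M = four_block_mat (e \<cdot>\<^sub>m 1\<^sub>m 1) (0\<^sub>m 1 n) (0\<^sub>m n 1) A3"
  proof (rule eq_matI, goal_cases)
    case (1 i j)
    then have ij: "i < Suc n" "j < Suc n" by (auto simp: A3_def)
    show ?case
      using ij M0[of i] M0[of j] Mcnj[of 0 j] by (cases i; cases j) (auto simp: A3_def)
  qed (use Mc in \<open>auto simp: A3_def\<close>)
  also have "\<dots> = F * rdiag (Suc n) d * adj F"
    unfolding Fadj Dd unfolding F_def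
    apply (subst mult_four_block_mat[where ?nr1.0=1 and ?n1.0=1 and ?nr2.0=n and ?n2.0=n and ?nc1.0=1 and ?nc2.0=n])
    using U3 apply auto[6]
    apply (subst mult_four_block_mat[where ?nr1.0=1 and ?n1.0=1 and ?nr2.0=n and ?n2.0=n and ?nc1.0=1 and ?nc2.0=n])
    using U3 by auto
  finally have MF: "M = F * rdiag (Suc n) d * adj F" .
  have "A = (W * adj W) * A * (W * adj W)" using Suc.prems by (simp add: WW')
  also have "\<dots> = W * M * adj W" using W Suc.prems by (simp add: M_def mult_mat_assoc)
  also have "\<dots> = (W * F) * rdiag (Suc n) d * adj (W * F)"
    using W Fc by (simp add: MF mult_mat_assoc adj_mult)
  finally have "A = (W * F) * rdiag (Suc n) d * adj (W * F)" .
  moreover have "adj (W * F) * (W * F) = adj F * ((adj W * W) * F)"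
    using W Fc by (simp add: mult_mat_assoc adj_mult)
  then have "unitary (W * F)" using W Fc FF by (simp add: unitary_iff[of _ "Suc n"] WW)
  ultimately show ?case using W Fc by (intro exI[of _ "W * F"] exI[of _ d]) simp
qed

text \<open>A unitary intertwining two diagonal matrices also intertwines any function of them, so
  the description operator in \<open>mat_fun\<close> has only one possible value.\<close>

lemma spectral_functional_calculus_unique:
  assumes U: "U \<in> carrier_mat n n" "unitary U" and U': "U' \<in> carrier_mat n n" "unitary U'"
    and eq: "U * rdiag n d * adj U = U' * rdiag n d' * adj U'"
  shows "U * rdiag n (\<lambda>i. f (d i)) * adj U = U' * rdiag n (\<lambda>i. f (d' i)) * adj U'"
proof -
  have u: "adj U * U = 1\<^sub>m n" "U * adj U = 1\<^sub>m n" "adj U' * U' = 1\<^sub>m n" "U' * adj U' = 1\<^sub>m n"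
    using assms by (auto simp: unitary_def)
  define C where "C = adj U' * U"
  have C: "C \<in> carrier_mat n n" using U U' by (auto simp: C_def)
  have "C * rdiag n d = adj U' * (U * rdiag n d * adj U) * U"
    using U U' by (simp add: C_def mult_mat_assoc u)
  also have "\<dots> = (adj U' * U') * rdiag n d' * C"
    unfolding eq using U U' by (simp add: C_def mult_mat_assoc)
  finally have CD: "C * rdiag n d = rdiag n d' * C" using C by (simp add: u left_mult_one_mat[of _ n n])
  have CF: "C * rdiag n (\<lambda>i. f (d i)) = rdiag n (\<lambda>i. f (d' i)) * C"
  proof (rule eq_matI)
    fix i j assume "i < dim_row (rdiag n (\<lambda>i. f (d' i)) * C)" "j < dim_col (rdiag n (\<lambda>i. f (d' i)) * C)"
    then have ij: "i < n" "j < n" using C by auto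
    have "C $$ (i, j) * complex_of_real (d j) = complex_of_real (d' i) * C $$ (i, j)"
      using arg_cong[OF CD, of "\<lambda>M. M $$ (i, j)"] ij C
      by (simp add: index_mult_rdiag index_rdiag_mult del: index_mult_mat(1))
    \<comment> \<open>A nonzero entry of \<open>C\<close> joins equal eigenvalues, hence also equal
      values of \<open>f\<close>.\<close>
    then have "C $$ (i, j) = 0 \<or> d j = d' i" by (auto simp: mult.commute)
    then show "(C * rdiag n (\<lambda>i. f (d i))) $$ (i, j) = (rdiag n (\<lambda>i. f (d' i)) * C) $$ (i, j)"
      using ij C by (auto simp: index_mult_rdiag index_rdiag_mult simp del: index_mult_mat(1))
  qed (use C in auto)
  have "U * rdiag n (\<lambda>i. f (d i)) * adj U = (U' * adj U') * (U * rdiag n (\<lambda>i. f (d i)) * adj U)"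
    using U U' by (simp add: u left_mult_one_mat[of _ n n])
  also have "\<dots> = U' * (C * rdiag n (\<lambda>i. f (d i))) * adj U"
    using U U' by (simp add: C_def mult_mat_assoc)
  also have "\<dots> = U' * rdiag n (\<lambda>i. f (d' i)) * adj U' * (U * adj U)"
    unfolding CF using U U' by (simp add: C_def mult_mat_assoc)
  finally show ?thesis using U U' by (simp add: u)
qed

lemma mat_fun_eq:
  assumes U: "U \<in> carrier_mat n n" "unitary U"
  shows "mat_fun f (U * rdiag n d * adj U) = U * rdiag n (\<lambda>i. f (d i)) * adj U"
proof -
  have [simp]: "dim_row U = n" using U by simp
  show ?thesis
    unfolding mat_fun_def
  proof (rule someI2_ex, goal_cases)
    case 1
    show ?case
      using U by (intro exI[of _ "U * rdiag n (\<lambda>i. f (d i)) * adj U"] exI[of _ U] exI[of _ d])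
        (simp add: rdiag_def)
  next
    case (2 M)
    then obtain U' d' where U': "U' \<in> carrier_mat n n" "unitary U'"
      "U * rdiag n d * adj U = U' * rdiag n d' * adj U'"
      "M = U' * rdiag n (\<lambda>i. f (d' i)) * adj U'"
      by (auto simp: rdiag_def)
    then show ?case using spectral_functional_calculus_unique[OF U U'(1,2,3)] by simp
  qed
qed

section \<open>Inequalities for finite sums\<close>

lemma norm_sum_mult_le:
  fixes f g :: "'a \<Rightarrow> complex"
  shows "(cmod (\<Sum>i\<in>I. f i * g i))\<^sup>2 \<le> (\<Sum>i\<in>I. (cmod (f i))\<^sup>2) * (\<Sum>i\<in>I. (cmod (g i))\<^sup>2)"
proof -
  have "cmod (\<Sum>i\<in>I. f i * g i) \<le> (\<Sum>i\<in>I. cmod (f i) * cmod (g i))"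
    by (rule order_trans[OF norm_sum]) (simp add: norm_mult)
  then have "(cmod (\<Sum>i\<in>I. f i * g i))\<^sup>2 \<le> (\<Sum>i\<in>I. cmod (f i) * cmod (g i))\<^sup>2"
    by (rule power_mono) simp
  also have "\<dots> \<le> (\<Sum>i\<in>I. (cmod (f i))\<^sup>2) * (\<Sum>i\<in>I. (cmod (g i))\<^sup>2)"
    by (rule Cauchy_Schwarz_ineq_sum)
  finally show ?thesis .
qed

lemma norm_sum_power2_le:
  fixes f :: "nat \<Rightarrow> complex"
  shows "(cmod (\<Sum>i<K. f i))\<^sup>2 \<le> real K * (\<Sum>i<K. (cmod (f i))\<^sup>2)"
  using norm_sum_mult_le[of "\<lambda>_. 1" f "{..<K}"] by simp

text \<open>The cross term is split by the arithmetic-geometric mean with a free weight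
  \<open>k\<close>, so that a small \<open>z\<close> can be charged heavily while \<open>g\<close>
  keeps a factor close to 1.\<close>

lemma norm_add_power2_le:
  fixes g z :: complex
  assumes "k > 0"
  shows "(cmod (g + z))\<^sup>2 \<le> (1 + k) * (cmod g)\<^sup>2 + (1 + 1 / k) * (cmod z)\<^sup>2"
proof -
  have "(cmod (g + z))\<^sup>2 \<le> (cmod g + cmod z)\<^sup>2"
    by (intro power_mono norm_triangle_ineq) auto
  also have "\<dots> = (cmod g)\<^sup>2 + (cmod z)\<^sup>2 + 2 * (cmod g * cmod z)"
    by (simp add: power2_eq_square algebra_simps)
  also have "2 * (cmod g * cmod z) \<le> k * (cmod g)\<^sup>2 + 1 / k * (cmod z)\<^sup>2"
  proof -
    have "0 \<le> (k * cmod g - cmod z)\<^sup>2 / k" using assms by simp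
    also have "\<dots> = k * (cmod g)\<^sup>2 + 1 / k * (cmod z)\<^sup>2 - 2 * (cmod g * cmod z)"
      using assms by (simp add: power2_eq_square field_simps)
    finally show ?thesis by simp
  qed
  finally show ?thesis by (simp add: algebra_simps)
qed

text \<open>The right side is the tangent at \<open>\<mu>\<close> to the concave function
  \<open>t powr \<theta>\<close>; this is Young's inequality for \<open>t / \<mu>\<close> and
  1.\<close>

lemma powr_le_affine:
  fixes t :: real
  assumes "0 < \<theta>" "\<theta> < 1" "t \<ge> 0" "\<mu> > 0"
  shows "t powr \<theta> \<le> \<mu> powr \<theta> * (1 - \<theta> + \<theta> * t / \<mu>)"
proof (cases "t = 0")
  case False
  then have "t / \<mu> > 0" using assms by simp
  then have "(t / \<mu>) powr \<theta> * 1 powr (1 - \<theta>) \<le> \<theta> * (t / \<mu>) + (1 - \<theta>) * 1"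
    using assms by (intro Youngs_inequality_0) auto
  then have "\<mu> powr \<theta> * (t / \<mu>) powr \<theta> \<le> \<mu> powr \<theta> * (1 - \<theta> + \<theta> * t / \<mu>)"
    by (intro mult_left_mono) auto
  moreover have "\<mu> powr \<theta> * (t / \<mu>) powr \<theta> = t powr \<theta>"
    using assms False by (simp flip: powr_mult)
  ultimately show ?thesis by simp
qed (use assms in auto)

text \<open>Hoelder's inequality for the conjugate exponents \<open>1 / (1 - \<theta>)\<close> and
  \<open>1 / \<theta>\<close>, by bounding every power with the same tangent line.\<close>

lemma sum_mult_powr_le:
  fixes w t :: "'a \<Rightarrow> real"
  assumes "finite A" "\<And>a. a \<in> A \<Longrightarrow> w a \<ge> 0" "\<And>a. a \<in> A \<Longrightarrow> t a \<ge> 0"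
    and "(\<Sum>a\<in>A. w a) \<le> x" "(\<Sum>a\<in>A. w a * t a) \<le> y" and "0 < x" "0 < y" "0 < \<theta>" "\<theta> < 1"
  shows "(\<Sum>a\<in>A. w a * t a powr \<theta>) \<le> x powr (1 - \<theta>) * y powr \<theta>"
proof -
  \<comment> \<open>The tangent is taken at the ratio of the two bounds, where the linear estimate
    \<open>(1 - \<theta>) * x + \<theta> / \<mu> * y\<close> collapses to \<open>x\<close>.\<close>
  define \<mu> where "\<mu> = y / x"
  have \<mu>: "\<mu> > 0" using assms by (simp add: \<mu>_def)
  have "(\<Sum>a\<in>A. w a * t a powr \<theta>) \<le> (\<Sum>a\<in>A. w a * (\<mu> powr \<theta> * (1 - \<theta> + \<theta> * t a / \<mu>)))"
    using assms \<mu> by (intro sum_mono mult_left_mono powr_le_affine) auto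
  also have "\<dots> = \<mu> powr \<theta> * ((1 - \<theta>) * (\<Sum>a\<in>A. w a) + \<theta> / \<mu> * (\<Sum>a\<in>A. w a * t a))"
    unfolding sum_distrib_left sum.distrib[symmetric] by (intro sum.cong) (auto simp: algebra_simps)
  also have "\<dots> \<le> \<mu> powr \<theta> * ((1 - \<theta>) * x + \<theta> / \<mu> * y)"
    using assms \<mu> by (intro mult_left_mono add_mono) auto
  also have "(1 - \<theta>) * x + \<theta> / \<mu> * y = x" using assms by (simp add: \<mu>_def field_simps)
  also have "\<mu> powr \<theta> * x = x powr (1 - \<theta>) * y powr \<theta>"
    using assms by (simp add: \<mu>_def powr_divide powr_diff)
  finally show ?thesis .
qed

text \<open>With \<open>r = sqrt (s a) / sqrt (p a)\<close>, the inequality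
  \<open>ln r \<le> r - 1\<close> turns the logarithm into square roots, term by term. The support
  hypothesis removes the terms with \<open>s a = 0\<close>.\<close>

lemma relative_entropy_lower_bound:
  fixes p s c :: "'a \<Rightarrow> real"
  assumes "\<And>a. a \<in> A \<Longrightarrow> p a \<ge> 0" "\<And>a. a \<in> A \<Longrightarrow> s a \<ge> 0" "\<And>a. a \<in> A \<Longrightarrow> c a \<ge> 0"
    and supp: "\<And>a. a \<in> A \<Longrightarrow> s a = 0 \<Longrightarrow> p a * c a = 0"
    and "(\<Sum>a\<in>A. p a * c a) = 1"
  shows "2 * (1 - (\<Sum>a\<in>A. sqrt (p a) * sqrt (s a) * c a)) \<le> (\<Sum>a\<in>A. p a * c a * (ln (p a) - ln (s a)))"
proof -
  have "2 * (p a * c a) - 2 * (sqrt (p a) * sqrt (s a) * c a) \<le> p a * c a * (ln (p a) - ln (s a))"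
    if a: "a \<in> A" for a
  proof (cases "p a * c a = 0")
    case False
    then have pos: "p a > 0" "c a > 0" "s a > 0"
      using assms(1-3)[OF a] supp[OF a] by (auto simp: less_le)
    define r where "r = sqrt (s a) / sqrt (p a)"
    have r: "r > 0" using pos by (simp add: r_def)
    have "ln (s a) - ln (p a) = 2 * ln r"
      using pos by (simp add: r_def ln_div ln_sqrt)
    also have "\<dots> \<le> 2 * (r - 1)" using ln_le_minus_one[OF r] by simp
    finally have "p a * c a * (2 * (1 - r)) \<le> p a * c a * (ln (p a) - ln (s a))"
      using pos by (intro mult_left_mono) auto
    moreover have "p a * r = sqrt (p a) * sqrt (s a)"
      using pos real_sqrt_mult_self[of "p a"] by (simp add: r_def field_simps flip: power2_eq_square)
    then have "p a * c a * (2 * (1 - r)) = 2 * (p a * c a) - 2 * (sqrt (p a) * sqrt (s a) * c a)"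
      by (simp add: algebra_simps)
    ultimately show ?thesis by simp
  qed auto
  then have "(\<Sum>a\<in>A. 2 * (p a * c a) - 2 * (sqrt (p a) * sqrt (s a) * c a))
      \<le> (\<Sum>a\<in>A. p a * c a * (ln (p a) - ln (s a)))"
    by (rule sum_mono)
  then show ?thesis using assms(5) by (simp add: sum_subtractf sum_distrib_left[symmetric])
qed

text \<open>The amplitudes split as \<open>g + z\<close>, where \<open>z\<close> has small weight \<open>\<epsilon>\<close> but likelihood ratios as large
  as \<open>k\<^sup>2\<close>. Using the Renyi-type weight \<open>t powr \<theta>\<close> instead of the logarithm interpolates between
  the two, so that \<open>z\<close> only contributes \<open>k powr \<theta> * \<epsilon> powr ((1 - \<theta>) / 2)\<close>.\<close>

lemma relative_entropy_upper_bound: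
  fixes g z :: "'a \<Rightarrow> complex" and t :: "'a \<Rightarrow> real"
  assumes A: "finite A" and t: "\<And>a. a \<in> A \<Longrightarrow> t a \<ge> 0" "\<And>a. a \<in> A \<Longrightarrow> t a = 0 \<Longrightarrow> g a + z a = 0"
    and one: "(\<Sum>a\<in>A. (cmod (g a + z a))\<^sup>2) = 1"
    and g: "(\<Sum>a\<in>A. (cmod (g a))\<^sup>2) \<le> 1" "(\<Sum>a\<in>A. (cmod (g a))\<^sup>2 * t a) \<le> 1"
    and z: "(\<Sum>a\<in>A. (cmod (z a))\<^sup>2) \<le> \<epsilon>" "(\<Sum>a\<in>A. (cmod (z a))\<^sup>2 * t a) \<le> k\<^sup>2"
    and par: "\<epsilon> > 0" "k > 0" "0 < \<theta>" "\<theta> < 1"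
  defines "\<eta> \<equiv> k powr \<theta> * \<epsilon> powr ((1 - \<theta>) / 2)"
  shows "(\<Sum>a\<in>A. (cmod (g a + z a))\<^sup>2 * ln (t a)) \<le> (2 * \<eta> + \<eta>\<^sup>2) / \<theta>"
proof -
  have \<eta>: "\<eta> > 0" using par by (simp add: \<eta>_def)
  define P where "P a = (cmod (g a + z a))\<^sup>2" for a
  have termwise: "\<theta> * (P a * ln (t a)) \<le> (1 + \<eta>) * ((cmod (g a))\<^sup>2 * t a powr \<theta>)
     + (1 + 1 / \<eta>) * ((cmod (z a))\<^sup>2 * t a powr \<theta>) - P a" if a: "a \<in> A" for a
  proof -
    \<comment> \<open>This is \<open>ln u \<le> u - 1\<close> at
      \<open>u = t a powr \<theta>\<close>; where \<open>t a = 0\<close>, the weight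
      \<open>P a\<close> vanishes.\<close>
    have "\<theta> * (P a * ln (t a)) \<le> P a * t a powr \<theta> - P a"
    proof (cases "t a = 0")
      case False
      then have pos: "t a > 0" using t[OF a] by simp
      have "\<theta> * ln (t a) \<le> t a powr \<theta> - 1"
        using ln_le_minus_one[of "t a powr \<theta>"] pos by (simp add: ln_powr)
      then have "P a * (\<theta> * ln (t a)) \<le> P a * (t a powr \<theta> - 1)"
        by (intro mult_left_mono) (auto simp: P_def)
      then show ?thesis by (simp add: algebra_simps)
    qed (use t(2)[OF a] in \<open>auto simp: P_def\<close>)
    also have "P a * t a powr \<theta> \<le> ((1 + \<eta>) * (cmod (g a))\<^sup>2 + (1 + 1 / \<eta>) * (cmod (z a))\<^sup>2) * t a powr \<theta>"
      unfolding P_def by (intro mult_right_mono norm_add_power2_le \<eta>) auto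
    finally show ?thesis by (simp add: algebra_simps)
  qed
  have "\<theta> * (\<Sum>a\<in>A. P a * ln (t a)) \<le> (\<Sum>a\<in>A. (1 + \<eta>) * ((cmod (g a))\<^sup>2 * t a powr \<theta>)
     + (1 + 1 / \<eta>) * ((cmod (z a))\<^sup>2 * t a powr \<theta>) - P a)"
    unfolding sum_distrib_left by (intro sum_mono termwise)
  also have "\<dots> = (1 + \<eta>) * (\<Sum>a\<in>A. (cmod (g a))\<^sup>2 * t a powr \<theta>)
     + (1 + 1 / \<eta>) * (\<Sum>a\<in>A. (cmod (z a))\<^sup>2 * t a powr \<theta>) - 1"
    using one by (simp add: sum_subtractf sum.distrib sum_distrib_left P_def)
  \<comment> \<open>The splitting weight was taken to be \<open>\<eta>\<close> because the
    \<open>z\<close> sum is at most \<open>\<eta>\<^sup>2\<close>: the corrections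
    \<open>\<eta> * 1\<close> and \<open>1 / \<eta> * \<eta>\<^sup>2\<close> then balance.\<close>
  also have "\<dots> \<le> (1 + \<eta>) * 1 + (1 + 1 / \<eta>) * \<eta>\<^sup>2 - 1"
  proof -
    have "(\<Sum>a\<in>A. (cmod (g a))\<^sup>2 * t a powr \<theta>) \<le> 1 powr (1 - \<theta>) * 1 powr \<theta>"
      using A t g par by (intro sum_mult_powr_le) auto
    moreover have "(\<Sum>a\<in>A. (cmod (z a))\<^sup>2 * t a powr \<theta>) \<le> \<epsilon> powr (1 - \<theta>) * (k\<^sup>2) powr \<theta>"
      using A t z par by (intro sum_mult_powr_le) auto
    moreover have "\<epsilon> powr ((1 - \<theta>) / 2) * \<epsilon> powr ((1 - \<theta>) / 2) = \<epsilon> powr (1 - \<theta>)"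
      by (simp flip: powr_add)
    then have "\<epsilon> powr (1 - \<theta>) * (k\<^sup>2) powr \<theta> = \<eta>\<^sup>2"
      by (simp add: \<eta>_def power2_eq_square powr_mult mult_ac)
    ultimately show ?thesis using \<eta> by (intro diff_right_mono add_mono mult_left_mono) auto
  qed
  also have "(1 + \<eta>) * 1 + (1 + 1 / \<eta>) * \<eta>\<^sup>2 - 1 = 2 * \<eta> + \<eta>\<^sup>2"
    using \<eta> by (simp add: field_simps power2_eq_square)
  finally have "\<theta> * (\<Sum>a\<in>A. P a * ln (t a)) \<le> 2 * \<eta> + \<eta>\<^sup>2" .
  then show ?thesis using par by (simp add: P_def field_simps)
qed

text \<open>If \<open>L\<^sup>\<dagger> L \<le> c diag s\<close>, then \<open>L (diag s)\<^sup>-\<^sup>1 L\<^sup>\<dagger> \<le> c\<close>; on the kernel of \<open>diag s\<close> the summands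
  vanish because \<open>x / 0 = 0\<close>.\<close>

lemma weighted_adjoint_bound:
  fixes L :: "'a \<Rightarrow> 'b \<Rightarrow> complex"
  assumes "finite J" and s: "\<And>j. j \<in> J \<Longrightarrow> s j \<ge> 0"
    and c: "c \<ge> 0"
    and L: "\<And>v. (\<Sum>n\<in>N. (cmod (\<Sum>j\<in>J. L n j * v j))\<^sup>2) \<le> c * (\<Sum>j\<in>J. s j * (cmod (v j))\<^sup>2)"
  shows "(\<Sum>j\<in>J. (cmod (\<Sum>n\<in>N. cnj (L n j) * u n))\<^sup>2 / s j) \<le> c * (\<Sum>n\<in>N. (cmod (u n))\<^sup>2)"
proof -
  define b where "b j = (\<Sum>n\<in>N. cnj (L n j) * u n)" for j
  \<comment> \<open>The hypothesis is tested on this \<open>v\<close>: \<open>q\<close> is both its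
    weighted squared norm and the inner product of \<open>L v\<close> with \<open>u\<close>, so
    Cauchy-Schwarz bounds \<open>q\<^sup>2\<close> by \<open>c * q\<close> times the squared norm of
    \<open>u\<close>.\<close>
  define v where "v j = b j / of_real (s j)" for j
  define q where "q = (\<Sum>j\<in>J. (cmod (b j))\<^sup>2 / s j)"
  have sv: "(\<Sum>j\<in>J. s j * (cmod (v j))\<^sup>2) = q"
    unfolding q_def using s by (intro sum.cong) (auto simp: v_def norm_divide power2_eq_square)
  have q0: "q \<ge> 0" unfolding q_def using s by (intro sum_nonneg) auto
  have "complex_of_real q = (\<Sum>j\<in>J. cnj (v j) * b j)"
    unfolding q_def v_def
    by (simp add: complex_norm_square mult.commute del: of_real_power)
  also have "\<dots> = (\<Sum>n\<in>N. cnj (\<Sum>j\<in>J. L n j * v j) * u n)"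
    unfolding b_def by (simp add: sum_distrib_left sum_distrib_right mult_ac sum.swap[of _ J N])
  finally have eq: "complex_of_real q = (\<Sum>n\<in>N. cnj (\<Sum>j\<in>J. L n j * v j) * u n)" .
  have "q\<^sup>2 = (cmod (complex_of_real q))\<^sup>2" by simp
  also have "\<dots> \<le> (\<Sum>n\<in>N. (cmod (\<Sum>j\<in>J. L n j * v j))\<^sup>2) * (\<Sum>n\<in>N. (cmod (u n))\<^sup>2)"
    unfolding eq using norm_sum_mult_le[of "\<lambda>n. cnj (\<Sum>j\<in>J. L n j * v j)" u N]
    by (simp only: complex_mod_cnj)
  also have "\<dots> \<le> (c * q) * (\<Sum>n\<in>N. (cmod (u n))\<^sup>2)"
    using L[of v] sv by (intro mult_right_mono sum_nonneg) auto
  finally have main: "q * q \<le> q * (c * (\<Sum>n\<in>N. (cmod (u n))\<^sup>2))" by (simp add: power2_eq_square mult_ac)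
  show ?thesis
  proof (cases "q = 0")
    case True
    then show ?thesis using c by (simp add: q_def b_def sum_nonneg)
  next
    case False
    then show ?thesis using main q0 by (simp add: q_def b_def)
  qed
qed

text \<open>Pythagoras for the Hilbert-Schmidt inner product: the subtracted matrix is the
  orthogonal projection of \<open>T\<close> onto the multiples of the identity.\<close>

lemma sum_norm_traceless:
  fixes T :: "nat \<Rightarrow> nat \<Rightarrow> complex"
  assumes "K > 0"
  defines "\<tau> \<equiv> (\<Sum>a<K. T a a)"
  shows "(\<Sum>a<K. \<Sum>b<K. (cmod (T a b - (if a = b then \<tau> / of_nat K else 0)))\<^sup>2)
    = (\<Sum>a<K. \<Sum>b<K. (cmod (T a b))\<^sup>2) - (cmod \<tau>)\<^sup>2 / real K"
proof -
  have sq: "(cmod (x - y))\<^sup>2 = (cmod x)\<^sup>2 + (cmod y)\<^sup>2 - 2 * Re (x * cnj y)" for x y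
    by (simp add: cmod_power2) (simp add: power2_eq_square algebra_simps)
  have row: "(\<Sum>b<K. (cmod (T a b - (if a = b then \<tau> / of_nat K else 0)))\<^sup>2)
      = (\<Sum>b<K. (cmod (T a b))\<^sup>2) + ((cmod (\<tau> / of_nat K))\<^sup>2 - 2 * Re (T a a * cnj (\<tau> / of_nat K)))"
    if "a < K" for a
  proof -
    define C where "C = (cmod (\<tau> / of_nat K))\<^sup>2 - 2 * Re (T a a * cnj (\<tau> / of_nat K))"
    have "(\<Sum>b<K. (cmod (T a b - (if a = b then \<tau> / of_nat K else 0)))\<^sup>2)
      = (\<Sum>b<K. (cmod (T a b))\<^sup>2 + (if b = a then C else 0))"
      unfolding C_def by (intro sum.cong refl) (auto simp: sq add_divide_distrib)
    also have "\<dots> = (\<Sum>b<K. (cmod (T a b))\<^sup>2) + C" using that by (simp add: sum.distrib)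
    finally show ?thesis unfolding C_def .
  qed
  have "(\<Sum>a<K. T a a * cnj (\<tau> / of_nat K)) = \<tau> * cnj (\<tau> / of_nat K)"
    unfolding sum_distrib_right[symmetric] by (simp add: \<tau>_def)
  also have "\<dots> = of_real ((cmod \<tau>)\<^sup>2 / real K)"
    by (simp add: complex_norm_square del: of_real_power)
  finally have "(\<Sum>a<K. Re (T a a * cnj (\<tau> / of_nat K))) = (cmod \<tau>)\<^sup>2 / real K"
    by (metis Re_complex_of_real Re_sum)
  moreover have "real K * (cmod (\<tau> / of_nat K))\<^sup>2 = (cmod \<tau>)\<^sup>2 / real K"
    using assms(1) by (simp add: norm_divide power2_eq_square)
  ultimately have "(\<Sum>a<K. (cmod (\<tau> / of_nat K))\<^sup>2 - 2 * Re (T a a * cnj (\<tau> / of_nat K))) = - (cmod \<tau>)\<^sup>2 / real K"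
    by (simp only: sum_subtractf sum_distrib_left[symmetric] sum_constant card_lessThan)
  moreover have "(\<Sum>a<K. \<Sum>b<K. (cmod (T a b - (if a = b then \<tau> / of_nat K else 0)))\<^sup>2)
      = (\<Sum>a<K. (\<Sum>b<K. (cmod (T a b))\<^sup>2) + ((cmod (\<tau> / of_nat K))\<^sup>2 - 2 * Re (T a a * cnj (\<tau> / of_nat K))))"
    by (intro sum.cong refl row) simp
  ultimately show ?thesis by (simp add: sum.distrib)
qed

section \<open>Relative entropy in terms of spectral data\<close>

lemma mult_diff_mat:
  assumes "dim_col A = dim_row B" "dim_row B = dim_row C" "dim_col B = dim_col C"
  shows "A * (B - C) = A * B - A * (C :: complex mat)"
  using assms by (intro mult_minus_distrib_mat[of A "dim_row A" "dim_row B" B "dim_col B" C]) auto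

lemma diff_mult_mat:
  assumes "dim_col B = dim_row A" "dim_row B = dim_row C" "dim_col B = dim_col C"
  shows "(B - C) * A = B * A - C * (A :: complex mat)"
  using assms by (intro minus_mult_distrib_mat[of B "dim_row B" "dim_col B" C A "dim_col A"]) auto

text \<open>By cyclicity the trace sees only \<open>adj Q * U\<close>, the matrix of overlaps
  between the two eigenbases.\<close>

lemma tr_mult_spectral:
  assumes "U \<in> carrier_mat n n" "Q \<in> carrier_mat n n"
  shows "tr ((U * rdiag n f * adj U) * (Q * rdiag n g * adj Q))
    = of_real (\<Sum>i<n. \<Sum>j<n. f i * g j * (cmod ((adj Q * U) $$ (j, i)))\<^sup>2)"
proof -
  define x where "x = adj Q * U"
  have x: "x \<in> carrier_mat n n" using assms by (auto simp: x_def)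
  have dims: "dim_row U = n" "dim_col U = n" "dim_row Q = n" "dim_col Q = n" "dim_row x = n" "dim_col x = n"
    using assms x by auto
  have "tr ((U * rdiag n f * adj U) * (Q * rdiag n g * adj Q))
    = tr (U * ((rdiag n f * adj U) * (Q * rdiag n g * adj Q)))"
    by (simp add: mult_mat_assoc dims)
  also have "\<dots> = tr (((rdiag n f * adj U) * (Q * rdiag n g * adj Q)) * U)"
    by (rule tr_mult_comm) (auto simp: dims)
  also have "((rdiag n f * adj U) * (Q * rdiag n g * adj Q)) * U = (rdiag n f * adj x) * (rdiag n g * x)"
    by (simp add: mult_mat_assoc dims adj_mult x_def)
  also have "tr ((rdiag n f * adj x) * (rdiag n g * x))
    = (\<Sum>i<n. \<Sum>j<n. (rdiag n f * adj x) $$ (i, j) * (rdiag n g * x) $$ (j, i))"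
    unfolding tr_def by (simp add: dims index_mult_mat_sum del: index_mult_mat(1))
  also have "\<dots> = (\<Sum>i<n. \<Sum>j<n. of_real (f i * g j * (cmod (x $$ (j, i)))\<^sup>2))"
    by (intro sum.cong refl)
      (simp add: index_rdiag_mult dims complex_norm_square del: index_mult_mat(1) of_real_power)
  finally show ?thesis by (simp add: x_def)
qed

lemma sum_norm_col_isometry:
  assumes "adj A * A = 1\<^sub>m (dim_col A)" "i < dim_col A"
  shows "(\<Sum>j<dim_row A. (cmod (A $$ (j, i)))\<^sup>2) = 1"
proof -
  have "complex_of_real (\<Sum>j<dim_row A. (cmod (A $$ (j, i)))\<^sup>2) = (adj A * A) $$ (i, i)"
    using assms(2)
    by (simp add: index_mult_mat_sum complex_norm_square mult.commute del: index_mult_mat(1) of_real_power)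
  also have "\<dots> = 1" using assms by simp
  finally show ?thesis by (simp only: of_real_eq_1_iff)
qed

lemma unitary_adj_mult:
  assumes "U \<in> carrier_mat n n" "unitary U" "Q \<in> carrier_mat n n" "unitary Q"
  shows "adj (adj Q * U) * (adj Q * U) = 1\<^sub>m n"
proof -
  have "adj (adj Q * U) * (adj Q * U) = adj U * ((Q * adj Q) * U)"
    using assms by (simp add: adj_mult mult_mat_assoc)
  then show ?thesis using assms by (simp add: unitary_def)
qed

lemma sum_norm_transition:
  assumes "U \<in> carrier_mat n n" "unitary U" "Q \<in> carrier_mat n n" "unitary Q" "i < n"
  shows "(\<Sum>j<n. (cmod ((adj Q * U) $$ (j, i)))\<^sup>2) = 1"
  using sum_norm_col_isometry[of "adj Q * U" i] unitary_adj_mult[OF assms(1-4)] assms by simp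

text \<open>The squared overlaps sum to 1 over \<open>j\<close>, so \<open>p i * ln (p i)\<close>
  can be spread over all pairs and merged with the cross term. For states this is the classical
  relative entropy of the Nussbaum-Szkola distributions, which reduces both entropy bounds to finite
  sums.\<close>

lemma rel_entropy_spectral:
  assumes U: "U \<in> carrier_mat n n" "unitary U" and Q: "Q \<in> carrier_mat n n" "unitary Q"
  shows "rel_entropy (U * rdiag n p * adj U) (Q * rdiag n s * adj Q)
    = (\<Sum>i<n. \<Sum>j<n. p i * (cmod ((adj Q * U) $$ (j, i)))\<^sup>2 * (ln (p i) - ln (s j)))"
proof -
  let ?R = "U * rdiag n p * adj U" and ?x = "\<lambda>j i. (cmod ((adj Q * U) $$ (j, i)))\<^sup>2"
  have "tr (?R * (mat_log ?R - mat_log (Q * rdiag n s * adj Q)))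
      = tr (?R * (U * rdiag n (\<lambda>i. ln (p i)) * adj U) - ?R * (Q * rdiag n (\<lambda>i. ln (s i)) * adj Q))"
    unfolding mat_log_def mat_fun_eq[OF U] mat_fun_eq[OF Q] using U Q
    by (subst mult_diff_mat) auto
  also have "\<dots> = tr (?R * (U * rdiag n (\<lambda>i. ln (p i)) * adj U)) - tr (?R * (Q * rdiag n (\<lambda>i. ln (s i)) * adj Q))"
    using U Q by (subst tr_diff) auto
  also have "tr (?R * (U * rdiag n (\<lambda>i. ln (p i)) * adj U)) = of_real (\<Sum>i<n. p i * ln (p i))"
  proof -
    have "adj U * U = 1\<^sub>m n" using U by (simp add: unitary_def)
    then have "(\<Sum>j<n. p i * ln (p j) * (cmod ((adj U * U) $$ (j, i)))\<^sup>2) = p i * ln (p i)" if "i < n" for i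
    proof -
      have "(\<Sum>j<n. p i * ln (p j) * (cmod ((adj U * U) $$ (j, i)))\<^sup>2) = (\<Sum>j<n. if j = i then p i * ln (p i) else 0)"
        unfolding \<open>adj U * U = 1\<^sub>m n\<close> using that by (intro sum.cong) auto
      then show ?thesis using that by simp
    qed
    then show ?thesis using U by (simp add: tr_mult_spectral del: index_mult_mat(1))
  qed
  also have "(\<Sum>i<n. p i * ln (p i)) = (\<Sum>i<n. \<Sum>j<n. p i * ?x j i * ln (p i))"
    by (intro sum.cong refl, simp only: sum_distrib_right[symmetric] sum_distrib_left[symmetric] lessThan_iff)
      (simp add: sum_norm_transition[OF U Q] del: index_mult_mat(1))
  also have "tr (?R * (Q * rdiag n (\<lambda>i. ln (s i)) * adj Q)) = of_real (\<Sum>i<n. \<Sum>j<n. p i * ?x j i * ln (s j))"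
    using U Q by (simp add: tr_mult_spectral mult_ac del: index_mult_mat(1))
  finally show ?thesis
    unfolding rel_entropy_def
    by (simp only: of_real_diff[symmetric] sum_subtractf[symmetric] right_diff_distrib[symmetric] Re_complex_of_real)
qed

section \<open>The state with decoupled marginal\<close>

text \<open>For an operator \<open>\<rho>\<close> on \<open>E \<otimes> R\<close> with \<open>dim R = K\<close>, indexed by \<open>u * K + q\<close>, this is
  \<open>tr\<^sub>R \<rho> \<otimes> I / K\<close>.\<close>

definition decoupled :: "nat \<Rightarrow> complex mat \<Rightarrow> complex mat" where
  "decoupled K \<rho> = mat (dim_row \<rho>) (dim_row \<rho>) (\<lambda>(i, j).
     if i mod K = j mod K then (\<Sum>b<K. \<rho> $$ (i div K * K + b, j div K * K + b)) / of_nat K else 0)"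

lemma decoupled_dim [simp]: "dim_row (decoupled K \<rho>) = dim_row \<rho>" "dim_col (decoupled K \<rho>) = dim_row \<rho>"
  by (simp_all add: decoupled_def)

lemma sum_blocks:
  "(\<Sum>i<m * K. f i) = (\<Sum>u<m. \<Sum>q<(K::nat). f (u * K + q))"
proof -
  have "(\<Sum>i<m * K. f i) = (\<Sum>u<m. sum f {u * K..<u * K + K})"
    by (simp add: sum.nat_group)
  also have "\<dots> = (\<Sum>u<m. \<Sum>q<K. f (u * K + q))"
  proof (rule sum.cong[OF refl])
    fix u
    show "sum f {u * K..<u * K + K} = (\<Sum>q<K. f (u * K + q))"
      using sum.shift_bounds_nat_ivl[of f 0 "u * K" K] by (simp add: add.commute lessThan_atLeast0)
  qed
  finally show ?thesis .
qed

lemma block_index_less: "u < m \<Longrightarrow> q < K \<Longrightarrow> u * K + q < m * (K::nat)"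
proof -
  assume "u < m" "q < K"
  then have "u * K + q < Suc u * K" by simp
  also have "\<dots> \<le> m * K" using \<open>u < m\<close> by (intro mult_right_mono) auto
  finally show ?thesis .
qed

lemma decoupled_index:
  assumes "u < m" "q < K" "v < m" "q' < K" "dim_row \<rho> = m * K"
  shows "decoupled K \<rho> $$ (u * K + q, v * K + q')
    = (if q = q' then (\<Sum>b<K. \<rho> $$ (u * K + b, v * K + b)) / of_nat K else 0)"
  using assms by (simp add: decoupled_def block_index_less)

lemma of_real_norm_power2: "complex_of_real ((cmod z)\<^sup>2) = cnj z * z"
  by (simp only: complex_norm_square mult.commute)

text \<open>The quadratic form of \<open>decoupled K (adj X * X)\<close>, written as a sum of
  squares so that positivity is visible: \<open>X\<close> is contracted with \<open>x\<close> over
  the environment index only, and both reference indices \<open>q\<close> and \<open>b\<close> stay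
  free.\<close>

definition decoupled_form :: "nat \<Rightarrow> nat \<Rightarrow> complex mat \<Rightarrow> (nat \<Rightarrow> complex) \<Rightarrow> real" where
  "decoupled_form K m X x =
     (\<Sum>n<dim_row X. \<Sum>q<K. \<Sum>b<K. (cmod (\<Sum>v<m. X $$ (n, v * K + b) * x (v * K + q)))\<^sup>2) / real K"

lemma decoupled_form_nonneg [simp]: "decoupled_form K m X x \<ge> 0"
  unfolding decoupled_form_def by (intro divide_nonneg_nonneg sum_nonneg) auto

lemma decoupled_form_eq:
  assumes X: "dim_col X = m * K"
  shows "(\<Sum>i<m * K. \<Sum>j<m * K. cnj (x i) * decoupled K (adj X * X) $$ (i, j) * x j)
    = of_real (decoupled_form K m X x)"
proof -
  have "(\<Sum>i<m * K. \<Sum>j<m * K. cnj (x i) * decoupled K (adj X * X) $$ (i, j) * x j)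
    = (\<Sum>u<m. \<Sum>q<K. \<Sum>v<m. \<Sum>q'<K. if q' = q then
         cnj (x (u * K + q)) * (\<Sum>b<K. \<Sum>n<dim_row X. cnj (X $$ (n, u * K + b)) * X $$ (n, v * K + b)) / of_nat K * x (v * K + q) else 0)"
    unfolding sum_blocks
    by (intro sum.cong refl)
      (auto simp: decoupled_index X block_index_less index_mult_mat_sum simp del: index_mult_mat(1))
  also have "\<dots> = (\<Sum>u<m. \<Sum>q<K. \<Sum>v<m.
         cnj (x (u * K + q)) * (\<Sum>b<K. \<Sum>n<dim_row X. cnj (X $$ (n, u * K + b)) * X $$ (n, v * K + b)) / of_nat K * x (v * K + q))"
    by (simp add: sum.delta)
  also have "\<dots> = (\<Sum>u<m. \<Sum>q<K. \<Sum>v<m. \<Sum>b<K. \<Sum>n<dim_row X.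
         cnj (X $$ (n, u * K + b) * x (u * K + q)) * (X $$ (n, v * K + b) * x (v * K + q))) / of_nat K"
    unfolding sum_divide_distrib sum_distrib_left sum_distrib_right
    by (intro sum.cong refl) (simp add: mult_ac)
  \<comment> \<open>With \<open>n\<close>, \<open>q\<close> and \<open>b\<close> moved outside, the
    sums over \<open>u\<close> and \<open>v\<close> form a squared modulus.\<close>
  also have "(\<Sum>u<m. \<Sum>q<K. \<Sum>v<m. \<Sum>b<K. \<Sum>n<dim_row X.
         cnj (X $$ (n, u * K + b) * x (u * K + q)) * (X $$ (n, v * K + b) * x (v * K + q)))
     = (\<Sum>n<dim_row X. \<Sum>q<K. \<Sum>b<K. \<Sum>u<m. \<Sum>v<m.
         cnj (X $$ (n, u * K + b) * x (u * K + q)) * (X $$ (n, v * K + b) * x (v * K + q)))"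
  proof -
    define f where "f u q v b n = cnj (X $$ (n, u * K + b) * x (u * K + q)) * (X $$ (n, v * K + b) * x (v * K + q))" for u q v b n
    have "(\<Sum>u<m. \<Sum>q<K. \<Sum>v<m. \<Sum>b<K. \<Sum>n<dim_row X. f u q v b n) = (\<Sum>u<m. \<Sum>q<K. \<Sum>v<m. \<Sum>n<dim_row X. \<Sum>b<K. f u q v b n)"
      by ((rule sum.cong[OF refl])+, rule sum.swap)
    also have "\<dots> = (\<Sum>u<m. \<Sum>q<K. \<Sum>n<dim_row X. \<Sum>v<m. \<Sum>b<K. f u q v b n)"
      by (((rule sum.cong[OF refl])+)?, rule sum.swap)
    also have "\<dots> = (\<Sum>u<m. \<Sum>n<dim_row X. \<Sum>q<K. \<Sum>v<m. \<Sum>b<K. f u q v b n)"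
      by (((rule sum.cong[OF refl])+)?, rule sum.swap)
    also have "\<dots> = (\<Sum>n<dim_row X. \<Sum>u<m. \<Sum>q<K. \<Sum>v<m. \<Sum>b<K. f u q v b n)"
      by (((rule sum.cong[OF refl])+)?, rule sum.swap)
    also have "\<dots> = (\<Sum>n<dim_row X. \<Sum>q<K. \<Sum>u<m. \<Sum>v<m. \<Sum>b<K. f u q v b n)"
      by (((rule sum.cong[OF refl])+)?, rule sum.swap)
    also have "\<dots> = (\<Sum>n<dim_row X. \<Sum>q<K. \<Sum>u<m. \<Sum>b<K. \<Sum>v<m. f u q v b n)"
      by (((rule sum.cong[OF refl])+)?, rule sum.swap)
    also have "\<dots> = (\<Sum>n<dim_row X. \<Sum>q<K. \<Sum>b<K. \<Sum>u<m. \<Sum>v<m. f u q v b n)"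
      by (((rule sum.cong[OF refl])+)?, rule sum.swap)
    finally show ?thesis by (simp only: f_def)
  qed
  also have "\<dots> = (\<Sum>n<dim_row X. \<Sum>q<K. \<Sum>b<K. of_real ((cmod (\<Sum>v<m. X $$ (n, v * K + b) * x (v * K + q)))\<^sup>2))"
    by (intro sum.cong refl) (simp only: of_real_norm_power2 cnj_sum sum_product)
  finally show ?thesis by (simp add: decoupled_form_def)
qed

text \<open>The operator inequality \<open>adj X * X \<le> K\<^sup>2 * \<sigma>\<close>. Applying
  \<open>X\<close> to \<open>x\<close> uses only the diagonal \<open>q = b\<close> of the
  contraction; Cauchy-Schwarz on its \<open>K\<close> terms costs one factor \<open>K\<close>, and
  the normalization of the form costs the other.\<close>

lemma norm_product_sum_le_decoupled_form:
  assumes X: "dim_col X = m * K"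
  shows "(\<Sum>n<dim_row X. (cmod (\<Sum>i<m * K. X $$ (n, i) * x i))\<^sup>2) \<le> (real K)\<^sup>2 * decoupled_form K m X x"
proof -
  have "(cmod (\<Sum>i<m * K. X $$ (n, i) * x i))\<^sup>2
     \<le> real K * (\<Sum>q<K. \<Sum>b<K. (cmod (\<Sum>v<m. X $$ (n, v * K + b) * x (v * K + q)))\<^sup>2)" for n
  proof -
    have "(\<Sum>i<m * K. X $$ (n, i) * x i) = (\<Sum>q<K. \<Sum>v<m. X $$ (n, v * K + q) * x (v * K + q))"
      unfolding sum_blocks by (rule sum.swap)
    then have "(cmod (\<Sum>i<m * K. X $$ (n, i) * x i))\<^sup>2
      \<le> real K * (\<Sum>q<K. (cmod (\<Sum>v<m. X $$ (n, v * K + q) * x (v * K + q)))\<^sup>2)"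
      by (simp only: norm_sum_power2_le)
    also have "\<dots> \<le> real K * (\<Sum>q<K. \<Sum>b<K. (cmod (\<Sum>v<m. X $$ (n, v * K + b) * x (v * K + q)))\<^sup>2)"
      by (intro mult_left_mono sum_mono member_le_sum[where f="\<lambda>b. (cmod (\<Sum>v<m. X $$ (n, v * K + b) * x (v * K + _)))\<^sup>2"]) auto
    finally show ?thesis .
  qed
  then have "(\<Sum>n<dim_row X. (cmod (\<Sum>i<m * K. X $$ (n, i) * x i))\<^sup>2)
     \<le> (\<Sum>n<dim_row X. real K * (\<Sum>q<K. \<Sum>b<K. (cmod (\<Sum>v<m. X $$ (n, v * K + b) * x (v * K + q)))\<^sup>2))"
    by (intro sum_mono)
  also have "\<dots> = (real K)\<^sup>2 * decoupled_form K m X x"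
    by (cases "K = 0") (simp_all add: decoupled_form_def power2_eq_square flip: sum_distrib_left)
  finally show ?thesis .
qed

lemma adj_mult_adj_mult_self:
  assumes "dim_col A = dim_row B"
  shows "adj (A * B) * (A * B) = adj B * (adj A * A) * B"
  using assms by (simp add: adj_mult mult_mat_assoc)

text \<open>\<open>T * adj T\<close> is an orthogonal projection, and the difference of the two
  sides is the squared norm of \<open>D\<close>, the part of \<open>G\<close> orthogonal to its
  range.\<close>

lemma frob_adj_partial_isometry_le:
  assumes T: "T * adj T * T = T" and dim: "dim_row G = dim_row T"
  shows "frob (adj T * G) \<le> frob G"
proof -
  define P where "P = T * adj T"
  define D where "D = G - P * G"
  have [simp]: "dim_row P = dim_row T" "dim_col P = dim_row T" by (simp_all add: P_def)
  have [simp]: "adj P = P" by (simp add: P_def adj_mult)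
  have PP: "P * P = P"
    using T by (simp add: P_def flip: mult_mat_assoc)
  have aD: "adj D = adj G - adj G * P"
  proof -
    have "adj D = adj G - adj (P * G)" unfolding D_def by (rule eq_matI) (use dim in auto)
    then show ?thesis using dim by (simp add: adj_mult)
  qed
  have PD: "P * D = P * G - P * G"
    using dim by (simp add: D_def mult_diff_mat flip: mult_mat_assoc) (simp add: PP)
  have "adj D * D = adj G * D - adj G * (P * D)"
    unfolding aD using dim by (subst diff_mult_mat) (auto simp: D_def mult_mat_assoc)
  also have "\<dots> = adj G * G - adj G * (P * G) - adj G * (P * G - P * G)"
    unfolding PD using dim by (subst D_def) (simp add: mult_diff_mat)
  also have "adj G * (P * G) = adj (adj T * G) * (adj T * G)"
    using dim by (simp add: P_def adj_mult mult_mat_assoc)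
  also have "adj G * (P * G - P * G) = 0\<^sub>m (dim_col G) (dim_col G)"
    using dim by (intro eq_matI) (auto simp: scalar_prod_def)
  finally have "of_real (frob D) = complex_of_real (frob G - frob (adj T * G))"
    using dim unfolding tr_adj_mult_self[symmetric] of_real_diff
    by (simp add: tr_def sum_subtractf)
  then have "frob D = frob G - frob (adj T * G)" by (simp only: of_real_eq_iff)
  then show ?thesis using frob_nonneg[of D] by simp
qed

text \<open>\<open>X\<close> is any factor of the state \<open>adj X * X\<close>, so the locale
  covers the code state both before and after a recovery is appended. The eigenbases are parameters
  because the recovery argument needs a product eigenbasis for the decoupled state.\<close>

locale decoupling =
  fixes X U Q :: "complex mat" and N m K :: nat and p s :: "nat \<Rightarrow> real"
  assumes X: "X \<in> carrier_mat N (m * K)" and K: "K > 0" and normalized: "frob X = 1"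
    and U: "U \<in> carrier_mat (m * K) (m * K)" "unitary U"
    and Q: "Q \<in> carrier_mat (m * K) (m * K)" "unitary Q"
    and rho: "adj X * X = U * rdiag (m * K) p * adj U"
    and sigma: "decoupled K (adj X * X) = Q * rdiag (m * K) s * adj Q"
begin

section \<open>Spectral data of the state and of its decoupled version\<close>

lemma dims [simp]:
  "dim_row X = N" "dim_col X = m * K" "dim_row U = m * K" "dim_col U = m * K"
  "dim_row Q = m * K" "dim_col Q = m * K"
  using X U Q by auto

lemma unitaries:
  "adj U * U = 1\<^sub>m (m * K)" "U * adj U = 1\<^sub>m (m * K)" "adj Q * Q = 1\<^sub>m (m * K)" "Q * adj Q = 1\<^sub>m (m * K)"
  using U Q by (auto simp: unitary_def)

lemma cancel_unitaries:
  assumes "dim_row A = m * K"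
  shows "adj U * (U * A) = A" "U * (adj U * A) = A" "adj Q * (Q * A) = A" "Q * (adj Q * A) = A"
proof -
  have A: "A \<in> carrier_mat (m * K) (dim_col A)" using assms by auto
  show "adj U * (U * A) = A" "U * (adj U * A) = A" "adj Q * (Q * A) = A" "Q * (adj Q * A) = A"
    using A by (simp_all add: unitaries flip: mult_mat_assoc)
qed

abbreviation x :: "nat \<Rightarrow> nat \<Rightarrow> complex" where
  "x j i \<equiv> (adj Q * U) $$ (j, i)"

lemma gram_XU: "adj (X * U) * (X * U) = rdiag (m * K) p"
  by (subst adj_mult_adj_mult_self) (simp_all add: rho mult_mat_assoc cancel_unitaries unitaries)

lemma p_eq: "i < m * K \<Longrightarrow> p i = (\<Sum>n<N. (cmod ((X * U) $$ (n, i)))\<^sup>2)"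
proof -
  assume i: "i < m * K"
  have "complex_of_real (\<Sum>n<N. (cmod ((X * U) $$ (n, i)))\<^sup>2) = (adj (X * U) * (X * U)) $$ (i, i)"
    using i by (subst index_mult_mat_sum) (auto simp: complex_norm_square mult.commute simp del: index_mult_mat(1) of_real_power)
  also have "\<dots> = of_real (p i)" unfolding gram_XU using i by simp
  finally show "p i = (\<Sum>n<N. (cmod ((X * U) $$ (n, i)))\<^sup>2)" by (simp only: of_real_eq_iff)
qed

lemma p_nonneg: "i < m * K \<Longrightarrow> p i \<ge> 0"
  by (simp only: p_eq) (intro sum_nonneg, simp)

lemma sum_p: "(\<Sum>i<m * K. p i) = 1"
proof -
  have "complex_of_real (\<Sum>i<m * K. p i) = tr (adj (X * U) * (X * U))"
    unfolding gram_XU by (simp add: tr_def)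
  also have "\<dots> = of_real (frob (adj (X * U)))" by (simp only: tr_adj_mult_self frob_adj)
  also have "frob (adj (X * U)) = frob (adj U * adj X)" by (simp add: adj_mult)
  also have "\<dots> = 1" by (subst frob_isometry_mult) (simp_all add: unitaries normalized)
  finally show ?thesis by (simp only: of_real_eq_iff)
qed

text \<open>In the basis \<open>Q\<close> the form is diagonal with coefficients \<open>s\<close>;
  this translates operator inequalities into weighted sums and yields
  \<open>s_nonneg\<close>.\<close>

lemma decoupled_form_spectral:
  "decoupled_form K m X (\<lambda>i. \<Sum>j<m * K. Q $$ (i, j) * v j) = (\<Sum>j<m * K. s j * (cmod (v j))\<^sup>2)"
proof -
  define V where "V = mat (m * K) 1 (\<lambda>(i, _). v i)"
  have [simp]: "dim_row V = m * K" "dim_col V = 1" by (simp_all add: V_def)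
  have Vi: "V $$ (i, 0) = v i" if "i < m * K" for i using that by (simp add: V_def)
  let ?y = "\<lambda>i. \<Sum>j<m * K. Q $$ (i, j) * v j"
  have y: "(Q * V) $$ (i, 0) = ?y i" if "i < m * K" for i
    using that by (simp add: index_mult_mat_sum Vi del: index_mult_mat(1))
  have "complex_of_real (decoupled_form K m X ?y)
     = (\<Sum>i<m * K. \<Sum>j<m * K. cnj (?y i) * decoupled K (adj X * X) $$ (i, j) * ?y j)"
    by (subst decoupled_form_eq) simp_all
  also have "\<dots> = (\<Sum>i<m * K. cnj (?y i) * (\<Sum>j<m * K. decoupled K (adj X * X) $$ (i, j) * ?y j))"
    by (simp only: sum_distrib_left mult.assoc)
  also have "\<dots> = (\<Sum>i<m * K. adj (Q * V) $$ (0, i) * (decoupled K (adj X * X) * (Q * V)) $$ (i, 0))"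
  proof (rule sum.cong[OF refl])
    fix i assume "i \<in> {..<m * K}"
    then have i: "i < m * K" by simp
    have "(decoupled K (adj X * X) * (Q * V)) $$ (i, 0) = (\<Sum>j<m * K. decoupled K (adj X * X) $$ (i, j) * (Q * V) $$ (j, 0))"
      using i by (subst index_mult_mat_sum) auto
    also have "\<dots> = (\<Sum>j<m * K. decoupled K (adj X * X) $$ (i, j) * ?y j)"
      using y by (intro sum.cong) auto
    finally show "cnj (?y i) * (\<Sum>j<m * K. decoupled K (adj X * X) $$ (i, j) * ?y j)
      = adj (Q * V) $$ (0, i) * (decoupled K (adj X * X) * (Q * V)) $$ (i, 0)"
      using i by (simp add: y del: index_mult_mat(1))
  qed
  also have "\<dots> = (adj (Q * V) * (decoupled K (adj X * X) * (Q * V))) $$ (0, 0)"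
    by (subst index_mult_mat_sum) auto
  also have "adj (Q * V) * (decoupled K (adj X * X) * (Q * V)) = adj V * (rdiag (m * K) s * V)"
    unfolding sigma by (simp add: adj_mult mult_mat_assoc cancel_unitaries)
  also have "(adj V * (rdiag (m * K) s * V)) $$ (0, 0) = of_real (\<Sum>j<m * K. s j * (cmod (v j))\<^sup>2)"
    by (simp add: index_mult_mat_sum[of _ "adj _"] index_rdiag_mult Vi of_real_norm_power2 mult_ac
        del: index_mult_mat(1) of_real_power)
  finally show ?thesis by (simp only: of_real_eq_iff)
qed

lemma s_nonneg: "j < m * K \<Longrightarrow> s j \<ge> 0"
proof -
  assume j: "j < m * K"
  have "(\<Sum>i<m * K. s i * (cmod (if i = j then 1 else 0))\<^sup>2) = (\<Sum>i<m * K. if i = j then s j else 0)"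
    by (intro sum.cong) auto
  also have "\<dots> = s j" using j by simp
  finally have "s j = decoupled_form K m X (\<lambda>i. \<Sum>k<m * K. Q $$ (i, k) * (if k = j then 1 else 0))"
    by (simp only: decoupled_form_spectral)
  then show ?thesis by (simp only: decoupled_form_nonneg)
qed

text \<open>The isometric factor in the polar decomposition of \<open>X\<close>, with columns indexed by the
  eigenvectors of \<open>\<rho>\<close>; columns with \<open>p i = 0\<close> vanish because \<open>1 / 0 = 0\<close>.\<close>

definition T :: "complex mat" where
  "T = X * U * rdiag (m * K) (\<lambda>i. 1 / sqrt (p i))"

lemma T_dim [simp]: "dim_row T = N" "dim_col T = m * K"
  by (simp_all add: T_def)

lemma rdiag_cong: "(\<And>i. i < n \<Longrightarrow> f i = g i) \<Longrightarrow> rdiag n f = rdiag n g"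
  by (intro eq_matI) auto

lemma gram_T: "adj T * T = rdiag (m * K) (\<lambda>i. if p i = 0 then 0 else 1)"
proof -
  have "adj T * T = rdiag (m * K) (\<lambda>i. 1 / sqrt (p i)) * rdiag (m * K) p * rdiag (m * K) (\<lambda>i. 1 / sqrt (p i))"
    unfolding T_def by (subst adj_mult_adj_mult_self) (simp_all add: gram_XU)
  also have "\<dots> = rdiag (m * K) (\<lambda>i. if p i = 0 then 0 else 1)"
    unfolding rdiag_mult by (rule rdiag_cong) (use p_nonneg in \<open>auto simp: field_simps\<close>)
  finally show ?thesis .
qed

lemma T_partial_isometry: "T * adj T * T = T"
proof -
  have "T * adj T * T = X * U * (rdiag (m * K) (\<lambda>i. 1 / sqrt (p i)) * rdiag (m * K) (\<lambda>i. if p i = 0 then 0 else 1))"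
    by (simp add: mult_mat_assoc gram_T) (simp add: T_def mult_mat_assoc)
  also have "rdiag (m * K) (\<lambda>i. 1 / sqrt (p i)) * rdiag (m * K) (\<lambda>i. if p i = 0 then 0 else 1)
      = rdiag (m * K) (\<lambda>i. 1 / sqrt (p i))"
    unfolding rdiag_mult by (rule rdiag_cong) auto
  finally show ?thesis by (simp add: T_def)
qed

text \<open>Polar decomposition: \<open>T * adj U\<close> is the isometric factor of
  \<open>X\<close>, and applying \<open>adj X\<close> to it leaves the square root of the state. The
  identity \<open>p / sqrt p = sqrt p\<close> also holds at 0.\<close>

lemma adj_X_T: "adj X * T = U * rdiag (m * K) (\<lambda>i. sqrt (p i))"
proof -
  have "adj X * T = (adj X * X) * U * rdiag (m * K) (\<lambda>i. 1 / sqrt (p i))"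
    by (simp add: T_def mult_mat_assoc)
  also have "\<dots> = U * (rdiag (m * K) p * rdiag (m * K) (\<lambda>i. 1 / sqrt (p i)))"
    unfolding rho by (simp add: mult_mat_assoc cancel_unitaries)
  also have "rdiag (m * K) p * rdiag (m * K) (\<lambda>i. 1 / sqrt (p i)) = rdiag (m * K) (\<lambda>i. sqrt (p i))"
    unfolding rdiag_mult by (rule rdiag_cong) (use p_nonneg real_div_sqrt in auto)
  finally show ?thesis .
qed

text \<open>For \<open>G = X\<close> these are the amplitudes \<open>sqrt (p i) * x j i\<close> behind the entropy formula; \<open>amp\<close> is
  additive, so a splitting of \<open>X\<close> splits the amplitudes.\<close>

definition amp :: "complex mat \<Rightarrow> complex mat" where
  "amp G = adj (G * Q) * T"

lemma amp_dim [simp]: "dim_row (amp G) = m * K" "dim_col (amp G) = m * K"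
  by (simp_all add: amp_def)

lemma amp_index:
  assumes "G \<in> carrier_mat N (m * K)" "j < m * K" "i < m * K"
  shows "amp G $$ (j, i) = (\<Sum>n<N. cnj ((G * Q) $$ (n, j)) * T $$ (n, i))"
  using assms unfolding amp_def by (subst index_mult_mat_sum) auto

lemma amp_X:
  assumes "j < m * K" "i < m * K"
  shows "amp X $$ (j, i) = x j i * of_real (sqrt (p i))"
proof -
  have "amp X = (adj Q * U) * rdiag (m * K) (\<lambda>i. sqrt (p i))"
    unfolding amp_def by (simp add: adj_mult mult_mat_assoc adj_X_T)
  then show ?thesis using assms by (simp add: index_mult_rdiag del: index_mult_mat(1))
qed

text \<open>Passing to amplitudes is a contraction, as \<open>Q\<close> is unitary and
  \<open>T\<close> a partial isometry; a part of \<open>X\<close> with small norm thus has small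
  total weight.\<close>

lemma frob_amp_le:
  assumes "G \<in> carrier_mat N (m * K)"
  shows "frob (amp G) \<le> frob G"
proof -
  have G: "dim_row G = N" "dim_col G = m * K" using assms by auto
  have "amp G = adj Q * (adj G * T)"
    unfolding amp_def using G by (simp add: adj_mult mult_mat_assoc)
  then have "frob (amp G) = frob (adj G * T)"
    by (simp only:, subst frob_isometry_mult) (simp_all add: unitaries G)
  also have "\<dots> = frob (adj T * G)"
    using frob_adj[of "adj T * G"] G by (simp add: adj_mult)
  also have "\<dots> \<le> frob G"
    using T_partial_isometry G by (intro frob_adj_partial_isometry_le) auto
  finally show ?thesis .
qed

section \<open>Consequences of an operator inequality
  \<open>adj G * G \<le> c * \<sigma>\<close>\<close>

context
  fixes G :: "complex mat" and c :: real
  assumes G: "G \<in> carrier_mat N (m * K)" and c: "c \<ge> 0"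
    and le: "\<And>y. (\<Sum>n<N. (cmod (\<Sum>i<m * K. G $$ (n, i) * y i))\<^sup>2) \<le> c * decoupled_form K m X y"
begin

lemma le_spectral:
  "(\<Sum>n<N. (cmod (\<Sum>j<m * K. (G * Q) $$ (n, j) * v j))\<^sup>2) \<le> c * (\<Sum>j<m * K. s j * (cmod (v j))\<^sup>2)"
proof -
  have "(\<Sum>j<m * K. (G * Q) $$ (n, j) * v j) = (\<Sum>i<m * K. G $$ (n, i) * (\<Sum>j<m * K. Q $$ (i, j) * v j))"
    if "n < N" for n
  proof -
    have "(\<Sum>j<m * K. (G * Q) $$ (n, j) * v j) = (\<Sum>j<m * K. \<Sum>i<m * K. G $$ (n, i) * Q $$ (i, j) * v j)"
      using that G by (simp add: index_mult_mat_sum sum_distrib_right del: index_mult_mat(1))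
    also have "\<dots> = (\<Sum>i<m * K. G $$ (n, i) * (\<Sum>j<m * K. Q $$ (i, j) * v j))"
      unfolding sum_distrib_left mult.assoc by (rule sum.swap)
    finally show ?thesis .
  qed
  then have "(\<Sum>n<N. (cmod (\<Sum>j<m * K. (G * Q) $$ (n, j) * v j))\<^sup>2)
     = (\<Sum>n<N. (cmod (\<Sum>i<m * K. G $$ (n, i) * (\<Sum>j<m * K. Q $$ (i, j) * v j)))\<^sup>2)" by simp
  also have "\<dots> \<le> c * decoupled_form K m X (\<lambda>i. \<Sum>j<m * K. Q $$ (i, j) * v j)" by (rule le)
  finally show ?thesis by (simp only: decoupled_form_spectral)
qed

text \<open>On a null vector of \<sigma> the inequality forces the corresponding column of
  \<open>G * Q\<close> to vanish.\<close>

lemma amp_eq_0: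
  assumes "j < m * K" "i < m * K" "s j = 0"
  shows "amp G $$ (j, i) = 0"
proof -
  have "(G * Q) $$ (n, j) = 0" if n: "n < N" for n
  proof -
    have "(\<Sum>n<N. (cmod ((G * Q) $$ (n, j)))\<^sup>2)
       = (\<Sum>n<N. (cmod (\<Sum>k<m * K. (G * Q) $$ (n, k) * (if k = j then 1 else 0)))\<^sup>2)"
      using assms by (simp add: if_distrib[of "\<lambda>z. _ * z"] cong: if_cong del: index_mult_mat(1))
    also have "\<dots> \<le> c * (\<Sum>k<m * K. s k * (cmod (if k = j then 1 else 0))\<^sup>2)"
      by (rule le_spectral)
    also have "(\<Sum>k<m * K. s k * (cmod (if k = j then 1 else 0))\<^sup>2) = 0"
      using assms by (intro sum.neutral) auto
    finally have "(\<Sum>n<N. (cmod ((G * Q) $$ (n, j)))\<^sup>2) = 0"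
      by (intro antisym sum_nonneg) auto
    then show ?thesis using n by (simp add: sum_nonneg_eq_0_iff del: index_mult_mat(1))
  qed
  then show ?thesis using assms G by (simp add: amp_index)
qed

text \<open>A bound on the weighted likelihood ratios \<open>p i / s j\<close>. For fixed
  \<open>i\<close>, \<open>weighted_adjoint_bound\<close> is applied to \<open>G * Q\<close> and
  column \<open>i\<close> of \<open>T\<close>, whose norm is at most 1; the weights
  \<open>p i\<close> then add up to 1.\<close>

lemma sum_norm_amp_weighted_le:
  "(\<Sum>i<m * K. \<Sum>j<m * K. (cmod (amp G $$ (j, i)))\<^sup>2 * (p i / s j)) \<le> c"
proof -
  have "(\<Sum>j<m * K. (cmod (amp G $$ (j, i)))\<^sup>2 / s j) \<le> c" if i: "i < m * K" for i
  proof -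
    have "(\<Sum>j<m * K. (cmod (amp G $$ (j, i)))\<^sup>2 / s j)
       = (\<Sum>j<m * K. (cmod (\<Sum>n<N. cnj ((G * Q) $$ (n, j)) * T $$ (n, i)))\<^sup>2 / s j)"
      using i G by (simp add: amp_index)
    also have "\<dots> \<le> c * (\<Sum>n<N. (cmod (T $$ (n, i)))\<^sup>2)"
      by (rule weighted_adjoint_bound) (use s_nonneg le_spectral c in auto)
    also have "(\<Sum>n<N. (cmod (T $$ (n, i)))\<^sup>2) \<le> 1"
    proof -
      have "complex_of_real (\<Sum>n<N. (cmod (T $$ (n, i)))\<^sup>2) = (adj T * T) $$ (i, i)"
        using i by (subst index_mult_mat_sum) (auto simp: complex_norm_square mult.commute simp del: of_real_power)
      also have "\<dots> = of_real (if p i = 0 then 0 else 1)" unfolding gram_T using i by simp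
      finally have "(\<Sum>n<N. (cmod (T $$ (n, i)))\<^sup>2) = (if p i = 0 then 0 else 1)" by (simp only: of_real_eq_iff)
      then show ?thesis by simp
    qed
    finally show ?thesis using c by (simp add: mult_left_mono)
  qed
  then have "(\<Sum>i<m * K. p i * (\<Sum>j<m * K. (cmod (amp G $$ (j, i)))\<^sup>2 / s j)) \<le> (\<Sum>i<m * K. p i * c)"
    by (intro sum_mono mult_left_mono) (use p_nonneg in auto)
  also have "\<dots> = c" by (simp add: sum_p flip: sum_distrib_right)
  finally show ?thesis by (simp add: sum_distrib_left mult_ac)
qed

end

section \<open>Support inclusion and the two bounds on the relative entropy\<close>

lemma X_bound:
  "(\<Sum>n<N. (cmod (\<Sum>i<m * K. X $$ (n, i) * y i))\<^sup>2) \<le> (real K)\<^sup>2 * decoupled_form K m X y"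
  using norm_product_sum_le_decoupled_form[of X m K y] by simp

text \<open>By \<open>adj X * X \<le> K\<^sup>2 * \<sigma>\<close>, null vectors of \<sigma> are
  null vectors of the state, so the convention \<open>ln 0 = 0\<close> never enters with positive
  weight.\<close>

lemma support:
  assumes "j < m * K" "i < m * K" "s j = 0"
  shows "p i * (cmod (x j i))\<^sup>2 = 0"
proof -
  have "amp X $$ (j, i) = 0"
    using amp_eq_0[of X "(real K)\<^sup>2", OF X _ X_bound assms] by simp
  then show ?thesis using amp_X[OF assms(1,2)] by (auto simp del: index_mult_mat(1))
qed

lemma rel_entropy_eq:
  "rel_entropy (adj X * X) (decoupled K (adj X * X))
    = (\<Sum>i<m * K. \<Sum>j<m * K. p i * (cmod (x j i))\<^sup>2 * (ln (p i) - ln (s j)))"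
  unfolding sigma by (simp only: rho rel_entropy_spectral[OF U Q])

lemma sum_transition: "i < m * K \<Longrightarrow> (\<Sum>j<m * K. (cmod (x j i))\<^sup>2) = 1"
  using sum_norm_transition[OF U Q] .

lemma sum_p_transition: "(\<Sum>i<m * K. \<Sum>j<m * K. p i * (cmod (x j i))\<^sup>2) = 1"
proof -
  have "(\<Sum>i<m * K. \<Sum>j<m * K. p i * (cmod (x j i))\<^sup>2) = (\<Sum>i<m * K. p i)"
    unfolding sum_distrib_left[symmetric] using sum_transition by (intro sum.cong) auto
  then show ?thesis by (simp add: sum_p)
qed

text \<open>By \<open>tr_mult_spectral\<close>, the double sum is the trace of the product of the
  square roots of the two states.\<close>

lemma rel_entropy_ge:
  "2 * (1 - (\<Sum>i<m * K. \<Sum>j<m * K. sqrt (p i) * sqrt (s j) * (cmod (x j i))\<^sup>2))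
     \<le> rel_entropy (adj X * X) (decoupled K (adj X * X))"
proof -
  let ?A = "{..<m * K} \<times> {..<m * K}"
  have "2 * (1 - (\<Sum>a\<in>?A. sqrt (p (fst a)) * sqrt (s (snd a)) * (cmod (x (snd a) (fst a)))\<^sup>2))
    \<le> (\<Sum>a\<in>?A. p (fst a) * (cmod (x (snd a) (fst a)))\<^sup>2 * (ln (p (fst a)) - ln (s (snd a))))"
  proof (rule relative_entropy_lower_bound)
    show "p (fst a) * (cmod (x (snd a) (fst a)))\<^sup>2 = 0" if "a \<in> ?A" "s (snd a) = 0" for a
      using support[of "snd a" "fst a"] that by auto
    show "(\<Sum>a\<in>?A. p (fst a) * (cmod (x (snd a) (fst a)))\<^sup>2) = 1"
      using sum_p_transition by (simp add: sum.cartesian_product split_beta del: index_mult_mat(1))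
  qed (use p_nonneg s_nonneg in auto)
  then show ?thesis by (simp add: rel_entropy_eq sum.cartesian_product split_beta del: index_mult_mat(1))
qed

text \<open>The classical bound is applied on the pairs \<open>(i, j)\<close>, with the amplitudes
  of \<open>H\<close> and \<open>Z\<close> and the ratio \<open>p i / s j\<close>; additivity of
  \<open>amp\<close> makes them add up to the amplitudes of \<open>X\<close>.\<close>

lemma rel_entropy_le:
  assumes H: "H \<in> carrier_mat N (m * K)" "frob H \<le> 1"
     "\<And>y. (\<Sum>n<N. (cmod (\<Sum>i<m * K. H $$ (n, i) * y i))\<^sup>2) \<le> 1 * decoupled_form K m X y"
    and Z: "Z \<in> carrier_mat N (m * K)" "frob Z \<le> \<epsilon>"
     "\<And>y. (\<Sum>n<N. (cmod (\<Sum>i<m * K. Z $$ (n, i) * y i))\<^sup>2) \<le> k\<^sup>2 * decoupled_form K m X y"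
    and XHZ: "X = H + Z" and par: "\<epsilon> > 0" "k > 0" "0 < \<theta>" "\<theta> < 1"
  defines "\<eta> \<equiv> k powr \<theta> * \<epsilon> powr ((1 - \<theta>) / 2)"
  shows "rel_entropy (adj X * X) (decoupled K (adj X * X)) \<le> (2 * \<eta> + \<eta>\<^sup>2) / \<theta>"
proof -
  let ?A = "{..<m * K} \<times> {..<m * K}"
  define g where "g a = amp H $$ (snd a, fst a)" for a
  define z where "z a = amp Z $$ (snd a, fst a)" for a
  define t where "t a = p (fst a) / s (snd a)" for a
  have dim: "dim_row H = N" "dim_col H = m * K" "dim_row Z = N" "dim_col Z = m * K"
    using H Z by auto
  have "(H + Z) * Q = H * Q + Z * Q"
    by (rule add_mult_distrib_mat[OF H(1) Z(1) Q(1)])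
  then have "adj ((H + Z) * Q) = adj (H * Q) + adj (Z * Q)"
    by (simp only:) (rule adj_add; simp add: dim)
  moreover have "(adj (H * Q) + adj (Z * Q)) * T = adj (H * Q) * T + adj (Z * Q) * T"
    by (rule add_mult_distrib_mat[of _ "m * K" N _ _ "m * K"]; rule carrier_matI; simp add: dim)
  ultimately have "amp (H + Z) = amp H + amp Z"
    unfolding amp_def by (simp only:)
  then have "amp X = amp H + amp Z" by (simp only: XHZ[symmetric])
  then have "g a + z a = amp X $$ (snd a, fst a)" if "a \<in> ?A" for a
    using that by (auto simp: g_def z_def)
  then have gz: "g a + z a = x (snd a) (fst a) * of_real (sqrt (p (fst a)))" if "a \<in> ?A" for a
    using that amp_X[of "snd a" "fst a"] by (auto simp del: index_mult_mat(1))
  have gz2: "(cmod (g a + z a))\<^sup>2 = p (fst a) * (cmod (x (snd a) (fst a)))\<^sup>2" if "a \<in> ?A" for a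
    unfolding gz[OF that] using that p_nonneg by (auto simp: norm_mult power_mult_distrib simp del: index_mult_mat(1))
  have frob: "frob (amp G) = (\<Sum>a\<in>?A. (cmod (amp G $$ (snd a, fst a)))\<^sup>2)" for G
    unfolding frob_def by (subst sum.swap) (simp add: sum.cartesian_product split_beta)
  have "(\<Sum>a\<in>?A. (cmod (g a + z a))\<^sup>2 * ln (t a)) \<le> (2 * \<eta> + \<eta>\<^sup>2) / \<theta>"
    unfolding \<eta>_def
  proof (rule relative_entropy_upper_bound)
    \<comment> \<open>\<open>t a = 0\<close> covers two cases: \<open>s = 0\<close>, by the
      convention \<open>x / 0 = 0\<close>, where both amplitudes vanish, and \<open>p = 0\<close>,
      where the amplitude of \<open>X\<close> has the factor \<open>sqrt p\<close>.\<close>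
    show "g a + z a = 0" if "a \<in> ?A" "t a = 0" for a
    proof (cases "s (snd a) = 0")
      case True
      then show ?thesis
        using that amp_eq_0[OF H(1) _ H(3)] amp_eq_0[OF Z(1) _ Z(3)] by (auto simp: g_def z_def)
    next
      case False
      then show ?thesis using that gz[OF that(1)] by (auto simp: t_def)
    qed
    show "(\<Sum>a\<in>?A. (cmod (g a + z a))\<^sup>2) = 1"
      using gz2 sum_p_transition by (simp add: sum.cartesian_product split_beta del: index_mult_mat(1))
    show "(\<Sum>a\<in>?A. (cmod (g a))\<^sup>2) \<le> 1" "(\<Sum>a\<in>?A. (cmod (z a))\<^sup>2) \<le> \<epsilon>"
      using frob_amp_le[OF H(1)] H(2) frob_amp_le[OF Z(1)] Z(2) by (auto simp: frob g_def z_def)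
    show "(\<Sum>a\<in>?A. (cmod (g a))\<^sup>2 * t a) \<le> 1" "(\<Sum>a\<in>?A. (cmod (z a))\<^sup>2 * t a) \<le> k\<^sup>2"
      using sum_norm_amp_weighted_le[OF H(1) _ H(3)] sum_norm_amp_weighted_le[OF Z(1) _ Z(3)]
      by (simp_all add: g_def z_def t_def sum.cartesian_product split_beta)
  qed (use par p_nonneg s_nonneg in \<open>auto simp: t_def\<close>)
  also have "(\<Sum>a\<in>?A. (cmod (g a + z a))\<^sup>2 * ln (t a)) = rel_entropy (adj X * X) (decoupled K (adj X * X))"
    unfolding rel_entropy_eq sum.cartesian_product
  proof (rule sum.cong[OF refl], goal_cases)
    case (1 a)
    obtain i j where a: "a = (i, j)" by (cases a)
    then have ij: "i \<in> {..<m * K}" "j \<in> {..<m * K}" using 1 by auto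
    \<comment> \<open>The logarithm of the quotient is split where \<open>p i\<close> and
      \<open>s j\<close> are positive; \<open>support\<close> ensures this wherever the weight is
      nonzero.\<close>
    have "(cmod (g (i, j) + z (i, j)))\<^sup>2 * ln (t (i, j)) = p i * (cmod (x j i))\<^sup>2 * (ln (p i) - ln (s j))"
    proof (cases "p i * (cmod (x j i))\<^sup>2 = 0")
      case True
      then show ?thesis using gz2[of "(i, j)"] ij by (simp del: index_mult_mat(1))
    next
      case False
      then have "p i > 0" "s j > 0"
        using p_nonneg[of i] s_nonneg[of j] support[of j i] ij by (auto simp: less_le simp del: index_mult_mat(1))
      then show ?thesis using gz2[of "(i, j)"] ij by (simp add: t_def ln_div del: index_mult_mat(1))
    qed
    then show ?case by (simp only: a split_conv)
  qed
  finally show ?thesis .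
qed

end

section \<open>Splitting off the scalar part of every block\<close>

definition block_trace :: "nat \<Rightarrow> complex mat \<Rightarrow> nat \<Rightarrow> nat \<Rightarrow> complex" where
  "block_trace K X e v = (\<Sum>q<K. X $$ (e * K + q, v * K + q))"

text \<open>The entanglement fidelity when the blocks of \<open>sqrt K * X\<close> are the Kraus operators.\<close>

definition block_fidelity :: "nat \<Rightarrow> nat \<Rightarrow> nat \<Rightarrow> complex mat \<Rightarrow> real" where
  "block_fidelity K r m X = (\<Sum>e<r. \<Sum>v<m. (cmod (block_trace K X e v))\<^sup>2) / real K"

definition scalar_part :: "nat \<Rightarrow> complex mat \<Rightarrow> complex mat" where
  "scalar_part K X = mat (dim_row X) (dim_col X) (\<lambda>(i, j).
     if i mod K = j mod K then block_trace K X (i div K) (j div K) / of_nat K else 0)"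

lemma frob_blocks:
  assumes "X \<in> carrier_mat (r * K) (m * K)"
  shows "frob X = (\<Sum>e<r. \<Sum>v<m. \<Sum>a<K. \<Sum>b<K. (cmod (X $$ (e * K + a, v * K + b)))\<^sup>2)"
proof -
  have "frob X = (\<Sum>e<r. \<Sum>a<K. \<Sum>v<m. \<Sum>b<K. (cmod (X $$ (e * K + a, v * K + b)))\<^sup>2)"
    using assms by (simp add: frob_def sum_blocks)
  also have "\<dots> = (\<Sum>e<r. \<Sum>v<m. \<Sum>a<K. \<Sum>b<K. (cmod (X $$ (e * K + a, v * K + b)))\<^sup>2)"
    by (rule sum.cong[OF refl], rule sum.swap)
  finally show ?thesis .
qed

context
  fixes X :: "complex mat" and r m K :: nat
  assumes X: "X \<in> carrier_mat (r * K) (m * K)" and K: "K > 0"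
begin

lemma scalar_part_carrier: "scalar_part K X \<in> carrier_mat (r * K) (m * K)"
  using X by (auto simp: scalar_part_def)

lemma scalar_part_index:
  assumes "e < r" "a < K" "v < m" "b < K"
  shows "scalar_part K X $$ (e * K + a, v * K + b) = (if a = b then block_trace K X e v / of_nat K else 0)"
  using assms X by (simp add: scalar_part_def block_index_less)

text \<open>Pythagoras in every block; when \<open>frob X = 1\<close>, the traceless part carries
  exactly the infidelity.\<close>

lemma frob_traceless_part: "frob (X - scalar_part K X) = frob X - block_fidelity K r m X"
proof -
  have "frob (X - scalar_part K X) = (\<Sum>e<r. \<Sum>v<m. \<Sum>a<K. \<Sum>b<K.
      (cmod (X $$ (e * K + a, v * K + b) - (if a = b then (\<Sum>c<K. X $$ (e * K + c, v * K + c)) / of_nat K else 0)))\<^sup>2)"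
  proof -
    have "X - scalar_part K X \<in> carrier_mat (r * K) (m * K)" using X scalar_part_carrier by auto
    then show ?thesis
      using X scalar_part_carrier
      by (subst frob_blocks) (auto intro!: sum.cong simp: block_index_less scalar_part_index block_trace_def)
  qed
  also have "\<dots> = (\<Sum>e<r. \<Sum>v<m. (\<Sum>a<K. \<Sum>b<K. (cmod (X $$ (e * K + a, v * K + b)))\<^sup>2)
      - (cmod (block_trace K X e v))\<^sup>2 / real K)"
    unfolding block_trace_def by (intro sum.cong refl sum_norm_traceless[OF K])
  also have "\<dots> = frob X - block_fidelity K r m X"
    by (simp add: frob_blocks[OF X] block_fidelity_def sum_subtractf sum_divide_distrib)
  finally show ?thesis .
qed

lemma block_fidelity_le: "block_fidelity K r m X \<le> frob X"
  using frob_traceless_part frob_nonneg[of "X - scalar_part K X"] by simp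

lemma frob_scalar_part: "frob (scalar_part K X) = block_fidelity K r m X"
proof -
  have "frob (scalar_part K X) = (\<Sum>e<r. \<Sum>v<m. \<Sum>a<K. \<Sum>b<K. if b = a then (cmod (block_trace K X e v / of_nat K))\<^sup>2 else 0)"
    unfolding frob_blocks[OF scalar_part_carrier] by (intro sum.cong refl) (simp add: scalar_part_index)
  also have "\<dots> = block_fidelity K r m X"
    using K by (simp add: block_fidelity_def norm_divide sum_divide_distrib power2_eq_square)
  finally show ?thesis .
qed

lemma decoupled_form_blocks:
  assumes "Y \<in> carrier_mat (r * K) (m * K)"
  shows "decoupled_form K m Y x = (\<Sum>e<r. \<Sum>q<K. \<Sum>a<K. \<Sum>b<K.
    (cmod (\<Sum>v<m. Y $$ (e * K + a, v * K + b) * x (v * K + q)))\<^sup>2) / real K"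
proof -
  have "(\<Sum>e<r. \<Sum>a<K. \<Sum>q<K. \<Sum>b<K. (cmod (\<Sum>v<m. Y $$ (e * K + a, v * K + b) * x (v * K + q)))\<^sup>2)
      = (\<Sum>e<r. \<Sum>q<K. \<Sum>a<K. \<Sum>b<K. (cmod (\<Sum>v<m. Y $$ (e * K + a, v * K + b) * x (v * K + q)))\<^sup>2)"
    by (rule sum.cong[OF refl], rule sum.swap)
  then show ?thesis using assms by (simp add: decoupled_form_def sum_blocks)
qed

context
  fixes x :: "nat \<Rightarrow> complex"
begin

text \<open>For fixed \<open>e\<close> and \<open>q\<close> this is a \<open>K\<close> by
  \<open>K\<close> matrix; the squared norms of these matrices add up to \<open>K\<close> times
  \<open>decoupled_form K m X x\<close>.\<close>

definition contr :: "nat \<Rightarrow> nat \<Rightarrow> nat \<Rightarrow> nat \<Rightarrow> complex" where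
  "contr e q a b = (\<Sum>v<m. X $$ (e * K + a, v * K + b) * x (v * K + q))"

lemma sum_contr_diag: "(\<Sum>a<K. contr e q a a) = (\<Sum>v<m. block_trace K X e v * x (v * K + q))"
  unfolding contr_def block_trace_def sum_distrib_right by (rule sum.swap)

text \<open>Row \<open>(e, q)\<close> of the scalar part sends \<open>x\<close> to the normalized
  trace of the matrix \<open>contr e q\<close>, and a squared trace is at most \<open>K\<close>
  times the squared norm. The powers of \<open>K\<close> cancel, so the constant is 1 in every code
  dimension.\<close>

lemma scalar_part_bound:
  "(\<Sum>n<r * K. (cmod (\<Sum>i<m * K. scalar_part K X $$ (n, i) * x i))\<^sup>2) \<le> 1 * decoupled_form K m X x"
proof -
  have eq: "(\<Sum>i<m * K. scalar_part K X $$ (e * K + q, i) * x i) = (\<Sum>a<K. contr e q a a) / of_nat K"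
    if "e < r" "q < K" for e q
  proof -
    have "(\<Sum>i<m * K. scalar_part K X $$ (e * K + q, i) * x i)
      = (\<Sum>v<m. \<Sum>b<K. if b = q then block_trace K X e v / of_nat K * x (v * K + q) else 0)"
      unfolding sum_blocks using that by (intro sum.cong refl) (simp add: scalar_part_index)
    then show ?thesis using that by (simp add: sum_contr_diag sum_divide_distrib)
  qed
  have le: "(cmod ((\<Sum>a<K. contr e q a a) / of_nat K))\<^sup>2 \<le> (\<Sum>a<K. \<Sum>b<K. (cmod (contr e q a b))\<^sup>2) / real K"
    for e q
  proof -
    define \<tau> where "\<tau> = (\<Sum>a<K. contr e q a a)"
    have "0 \<le> (\<Sum>a<K. \<Sum>b<K. (cmod (contr e q a b - (if a = b then \<tau> / of_nat K else 0)))\<^sup>2)"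
      by (intro sum_nonneg) auto
    then have "(cmod \<tau>)\<^sup>2 / real K \<le> (\<Sum>a<K. \<Sum>b<K. (cmod (contr e q a b))\<^sup>2)"
      unfolding \<tau>_def sum_norm_traceless[OF K] by simp
    then have "(cmod \<tau>)\<^sup>2 / real K / real K \<le> (\<Sum>a<K. \<Sum>b<K. (cmod (contr e q a b))\<^sup>2) / real K"
      by (rule divide_right_mono) simp
    then show ?thesis by (simp add: \<tau>_def norm_divide power_divide power2_eq_square)
  qed
  have "(\<Sum>n<r * K. (cmod (\<Sum>i<m * K. scalar_part K X $$ (n, i) * x i))\<^sup>2)
      = (\<Sum>e<r. \<Sum>q<K. (cmod ((\<Sum>a<K. contr e q a a) / of_nat K))\<^sup>2)"
    unfolding sum_blocks[where m=r] by (intro sum.cong refl arg_cong[where f="\<lambda>z. (cmod z)\<^sup>2"] eq) auto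
  also have "\<dots> \<le> (\<Sum>e<r. \<Sum>q<K. (\<Sum>a<K. \<Sum>b<K. (cmod (contr e q a b))\<^sup>2) / real K)"
    by (intro sum_mono le)
  also have "\<dots> = 1 * decoupled_form K m X x"
    unfolding decoupled_form_blocks[OF X] contr_def by (simp add: sum_divide_distrib)
  finally show ?thesis .
qed

text \<open>The general factor \<open>K\<^sup>2\<close> holds relative to the form of the traceless
  part itself. Contracting that part with \<open>x\<close> gives the traceless part of
  \<open>contr e q\<close>, which has no larger norm, so its form is at most that of
  \<open>X\<close>.\<close>

lemma traceless_part_bound:
  "(\<Sum>n<r * K. (cmod (\<Sum>i<m * K. (X - scalar_part K X) $$ (n, i) * x i))\<^sup>2) \<le> (real K)\<^sup>2 * decoupled_form K m X x"
proof -
  let ?Z = "X - scalar_part K X"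
  have Z: "?Z \<in> carrier_mat (r * K) (m * K)" using X scalar_part_carrier by auto
  have contr_Z: "(\<Sum>v<m. ?Z $$ (e * K + a, v * K + b) * x (v * K + q))
      = contr e q a b - (if a = b then (\<Sum>a<K. contr e q a a) / of_nat K else 0)"
    if "e < r" "a < K" "b < K" for e q a b
  proof -
    have "(\<Sum>v<m. ?Z $$ (e * K + a, v * K + b) * x (v * K + q))
      = (\<Sum>v<m. X $$ (e * K + a, v * K + b) * x (v * K + q)
          - (if a = b then block_trace K X e v / of_nat K * x (v * K + q) else 0))"
    proof (rule sum.cong[OF refl])
      fix v assume "v \<in> {..<m}"
      then have v: "v < m" by simp
      have "?Z $$ (e * K + a, v * K + b) = X $$ (e * K + a, v * K + b) - scalar_part K X $$ (e * K + a, v * K + b)"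
        using that v X scalar_part_carrier by (auto simp: block_index_less)
      then show "?Z $$ (e * K + a, v * K + b) * x (v * K + q) = X $$ (e * K + a, v * K + b) * x (v * K + q)
          - (if a = b then block_trace K X e v / of_nat K * x (v * K + q) else 0)"
        using that v by (simp add: scalar_part_index left_diff_distrib)
    qed
    then show ?thesis by (simp add: sum_subtractf contr_def[symmetric] sum_contr_diag sum_divide_distrib)
  qed
  have "(\<Sum>n<r * K. (cmod (\<Sum>i<m * K. ?Z $$ (n, i) * x i))\<^sup>2) \<le> (real K)\<^sup>2 * decoupled_form K m ?Z x"
    using norm_product_sum_le_decoupled_form[of ?Z m K x] X scalar_part_carrier by simp
  also have "decoupled_form K m ?Z x = (\<Sum>e<r. \<Sum>q<K. \<Sum>a<K. \<Sum>b<K.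
      (cmod (contr e q a b - (if a = b then (\<Sum>a<K. contr e q a a) / of_nat K else 0)))\<^sup>2) / real K"
    unfolding decoupled_form_blocks[OF Z]
    by (intro sum.cong refl arg_cong2[where f="(/)"] arg_cong[where f="\<lambda>z. (cmod z)\<^sup>2"] contr_Z) auto
  also have "\<dots> \<le> (\<Sum>e<r. \<Sum>q<K. \<Sum>a<K. \<Sum>b<K. (cmod (contr e q a b))\<^sup>2) / real K"
    unfolding sum_norm_traceless[OF K] by (intro divide_right_mono sum_mono) auto
  also have "\<dots> = decoupled_form K m X x"
    unfolding decoupled_form_blocks[OF X] contr_def ..
  finally show ?thesis by (simp add: mult_left_mono)
qed

end

end

section \<open>The product structure of the decoupled state\<close>

text \<open>\<open>A\<close> tensored with the identity on the second factor, in the index encoding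
  \<open>u * K + q\<close>.\<close>

definition kron_id :: "nat \<Rightarrow> complex mat \<Rightarrow> complex mat" where
  "kron_id K A = mat (dim_row A * K) (dim_col A * K) (\<lambda>(i, j).
     if i mod K = j mod K then A $$ (i div K, j div K) else 0)"

lemma kron_id_dim [simp]: "dim_row (kron_id K A) = dim_row A * K" "dim_col (kron_id K A) = dim_col A * K"
  by (simp_all add: kron_id_def)

lemma block_index_cases:
  assumes "i < n * K"
  obtains u q where "u < n" "q < K" "i = u * K + (q :: nat)"
proof
  have "K > 0" using assms by (cases K) auto
  show "i div K < n" using assms by (simp add: less_mult_imp_div_less)
  show "i mod K < K" using \<open>K > 0\<close> by simp
  show "i = i div K * K + i mod K" by simp
qed

lemma kron_id_index [simp]:
  assumes "u < dim_row A" "q < K" "v < dim_col A" "q' < K"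
  shows "kron_id K A $$ (u * K + q, v * K + q') = (if q = q' then A $$ (u, v) else 0)"
  using assms by (simp add: kron_id_def block_index_less)

lemma eq_mat_blocksI:
  assumes "A \<in> carrier_mat (n * K) (m * K)" "B \<in> carrier_mat (n * K) (m * K)"
    and "\<And>u q v q'. u < n \<Longrightarrow> q < K \<Longrightarrow> v < m \<Longrightarrow> q' < K \<Longrightarrow> A $$ (u * K + q, v * K + q') = B $$ (u * K + q, v * K + q')"
  shows "A = B"
proof (rule eq_matI)
  fix i j assume "i < dim_row B" "j < dim_col B"
  then have "i < n * K" "j < m * K" using assms by auto
  then show "A $$ (i, j) = B $$ (i, j)" using assms(3) by (metis block_index_cases)
qed (use assms in auto)

lemma kron_id_mult:
  assumes "dim_col A = dim_row B"
  shows "kron_id K A * kron_id K B = kron_id K (A * B)"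
proof (rule eq_mat_blocksI[of _ "dim_row A" K "dim_col B"], goal_cases)
  case (3 u q v q')
  have "(kron_id K A * kron_id K B) $$ (u * K + q, v * K + q')
     = (\<Sum>w<dim_row B. \<Sum>c<K. kron_id K A $$ (u * K + q, w * K + c) * kron_id K B $$ (w * K + c, v * K + q'))"
    using 3 assms by (subst index_mult_mat_sum) (auto simp: block_index_less sum_blocks)
  also have "\<dots> = (\<Sum>w<dim_row B. \<Sum>c<K. if c = q then (if q = q' then A $$ (u, w) * B $$ (w, v) else 0) else 0)"
    using 3 assms by (intro sum.cong refl) auto
  also have "\<dots> = kron_id K (A * B) $$ (u * K + q, v * K + q')"
    using 3 assms by (simp add: index_mult_mat_sum del: index_mult_mat(1))
  finally show ?case .
qed auto

lemma adj_kron_id: "adj (kron_id K A) = kron_id K (adj A)"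
  by (rule eq_mat_blocksI[of _ "dim_col A" K "dim_row A"]) (auto simp: block_index_less)

lemma kron_id_rdiag: "kron_id K (rdiag n d) = rdiag (n * K) (\<lambda>i. d (i div K))"
proof (rule eq_mat_blocksI[of _ n K n])
  fix u q v q' assume *: "u < n" "q < K" "v < n" "q' < K"
  have "u * K + q = v * K + q' \<longleftrightarrow> u = v \<and> q = q'"
  proof
    assume eq: "u * K + q = v * K + q'"
    have "(u * K + q) div K = u" "(v * K + q') div K = v" using * by auto
    then have "u = v" using eq by simp
    then show "u = v \<and> q = q'" using eq by simp
  qed simp
  then show "kron_id K (rdiag n d) $$ (u * K + q, v * K + q') = rdiag (n * K) (\<lambda>i. d (i div K)) $$ (u * K + q, v * K + q')"
    using * by (auto simp: block_index_less)
qed auto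

lemma kron_id_one: "kron_id K (1\<^sub>m n) = 1\<^sub>m (n * K)"
proof -
  have "rdiag k (\<lambda>_. 1) = 1\<^sub>m k" for k by (intro eq_matI) auto
  then show ?thesis using kron_id_rdiag[of K n "\<lambda>_. 1"] by simp
qed

text \<open>The reduced environment state, with the factor \<open>1 / K\<close> of the maximally
  mixed reference absorbed.\<close>

definition block_marginal :: "nat \<Rightarrow> nat \<Rightarrow> complex mat \<Rightarrow> complex mat" where
  "block_marginal K m \<rho> = mat m m (\<lambda>(u, v). (\<Sum>b<K. \<rho> $$ (u * K + b, v * K + b)) / of_nat K)"

lemma decoupled_eq_kron_id:
  assumes "\<rho> \<in> carrier_mat (m * K) (m * K)"
  shows "decoupled K \<rho> = kron_id K (block_marginal K m \<rho>)"
proof (rule eq_mat_blocksI[of _ m K m])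
  fix u q v q' assume *: "u < m" "q < K" "v < m" "q' < K"
  have "block_marginal K m \<rho> $$ (u, v) = (\<Sum>b<K. \<rho> $$ (u * K + b, v * K + b)) / of_nat K"
    using * by (simp add: block_marginal_def)
  then show "decoupled K \<rho> $$ (u * K + q, v * K + q') = kron_id K (block_marginal K m \<rho>) $$ (u * K + q, v * K + q')"
    using * assms by (subst kron_id_index) (auto simp: decoupled_index[of u m q K v q' \<rho>] block_marginal_def)
qed (use assms in \<open>auto simp: block_marginal_def\<close>)

lemma kron_id_spectral:
  assumes "q \<in> carrier_mat m m" "unitary q"
  shows "kron_id K q \<in> carrier_mat (m * K) (m * K)" "unitary (kron_id K q)"
    "kron_id K (q * rdiag m l * adj q) = kron_id K q * rdiag (m * K) (\<lambda>i. l (i div K)) * adj (kron_id K q)"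
proof -
  show c: "kron_id K q \<in> carrier_mat (m * K) (m * K)" using assms by auto
  have "adj q * q = 1\<^sub>m m" using assms by (simp add: unitary_def)
  then show "unitary (kron_id K q)"
    using assms by (simp add: unitary_iff[OF c] adj_kron_id kron_id_mult kron_id_one)
  show "kron_id K (q * rdiag m l * adj q) = kron_id K q * rdiag (m * K) (\<lambda>i. l (i div K)) * adj (kron_id K q)"
    using assms by (simp add: adj_kron_id kron_id_mult flip: kron_id_rdiag)
qed

text \<open>Diagonalizing the small marginal instead of the decoupled state gives the latter a
  product eigenbasis, so its square root is again of the form \<open>kron_id K A\<close>.\<close>

lemma decoupling_exists:
  assumes X: "X \<in> carrier_mat N (m * K)" and K: "K > 0" and "frob X = 1"
  obtains U q p l where "q \<in> carrier_mat m m" "unitary q"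
    "block_marginal K m (adj X * X) = q * rdiag m l * adj q"
    "decoupling X U (kron_id K q) N m K p (\<lambda>i. l (i div K))"
proof -
  let ?\<rho> = "adj X * X"
  have r: "?\<rho> \<in> carrier_mat (m * K) (m * K)" using X by auto
  have rh: "adj ?\<rho> = ?\<rho>" by (simp add: adj_mult)
  then obtain U p where U: "U \<in> carrier_mat (m * K) (m * K)" "unitary U" "?\<rho> = U * rdiag (m * K) p * adj U"
    using hermitian_spectral[OF r] by blast
  have mc: "block_marginal K m ?\<rho> \<in> carrier_mat m m" by (simp add: block_marginal_def)
  have "cnj (?\<rho> $$ (i, j)) = ?\<rho> $$ (j, i)" if "i < m * K" "j < m * K" for i j
  proof -
    have "adj ?\<rho> $$ (j, i) = cnj (?\<rho> $$ (i, j))" using that r by (intro adj_index) auto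
    then show ?thesis by (simp only: rh)
  qed
  then have "adj (block_marginal K m ?\<rho>) = block_marginal K m ?\<rho>"
    by (intro eq_matI) (auto simp: block_marginal_def block_index_less simp del: index_mult_mat(1))
  then obtain q l where q: "q \<in> carrier_mat m m" "unitary q" "block_marginal K m ?\<rho> = q * rdiag m l * adj q"
    using hermitian_spectral[OF mc] by blast
  have "decoupled K ?\<rho> = kron_id K q * rdiag (m * K) (\<lambda>i. l (i div K)) * adj (kron_id K q)"
    unfolding decoupled_eq_kron_id[OF r] q(3) by (rule kron_id_spectral(3)[OF q(1,2)])
  then have "decoupling X U (kron_id K q) N m K p (\<lambda>i. l (i div K))"
    using assms U q kron_id_spectral(1,2)[OF q(1,2)] by unfold_locales auto
  with q that show ?thesis by blast
qed

text \<open>The scalar and traceless parts serve as \<open>H\<close> and \<open>Z\<close>, with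
  \<open>k = K\<close>. Here \<epsilon> may exceed the infidelity, which keeps it positive when the
  fidelity is 1.\<close>

theorem rel_entropy_le_of_block_fidelity:
  assumes X: "X \<in> carrier_mat (r * K) (m * K)" and K: "K > 0" and norm: "frob X = 1"
    and eps: "1 - block_fidelity K r m X \<le> \<epsilon>" "\<epsilon> > 0" and th: "0 < \<theta>" "\<theta> < 1"
  defines "\<eta> \<equiv> real K powr \<theta> * \<epsilon> powr ((1 - \<theta>) / 2)"
  shows "rel_entropy (adj X * X) (decoupled K (adj X * X)) \<le> (2 * \<eta> + \<eta>\<^sup>2) / \<theta>"
proof -
  obtain U q p l where "decoupling X U (kron_id K q) (r * K) m K p (\<lambda>i. l (i div K))"
    using decoupling_exists[OF X K norm] by metis
  then interpret decoupling X U "kron_id K q" "r * K" m K p "\<lambda>i. l (i div K)" .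
  show ?thesis
    unfolding \<eta>_def
  proof (rule rel_entropy_le)
    show "scalar_part K X \<in> carrier_mat (r * K) (m * K)" by (rule scalar_part_carrier[OF X K])
    then show "X - scalar_part K X \<in> carrier_mat (r * K) (m * K)" by auto
    show "frob (scalar_part K X) \<le> 1" using frob_scalar_part[OF X K] block_fidelity_le[OF X K] norm by simp
    show "frob (X - scalar_part K X) \<le> \<epsilon>" using frob_traceless_part[OF X K] norm eps by simp
    show "X = scalar_part K X + (X - scalar_part K X)"
      using \<open>scalar_part K X \<in> _\<close> by (intro eq_matI) auto
    show "0 < real K" using K by (simp only: of_nat_0_less_iff)
  qed (rule scalar_part_bound[OF X K] traceless_part_bound[OF X K] eps th)+
qed

text \<open>\<open>W\<close> is the isometric factor of \<open>X\<close>, so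
  \<open>adj W * X\<close> is the square root of the state, and its overlap with the square root of
  the decoupled state depends only on the block traces.\<close>

theorem partial_isometry_recovery:
  assumes X: "X \<in> carrier_mat N (m * K)" and K: "K > 0" and norm: "frob X = 1"
  obtains W where "W \<in> carrier_mat N (m * K)" "W * adj W * W = W"
    "2 * (1 - sqrt (block_fidelity K m m (adj W * X))) \<le> rel_entropy (adj X * X) (decoupled K (adj X * X))"
    "block_fidelity K m m (adj W * X) \<le> 1"
proof -
  obtain U q p l where q: "q \<in> carrier_mat m m" "unitary q"
    and marg: "block_marginal K m (adj X * X) = q * rdiag m l * adj q"
    and dec: "decoupling X U (kron_id K q) N m K p (\<lambda>i. l (i div K))"
    using decoupling_exists[OF X K norm] by metis
  interpret decoupling X U "kron_id K q" N m K p "\<lambda>i. l (i div K)" by (rule dec)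
  define W where "W = T * adj U"
  define R where "R = adj W * X"
  \<comment> \<open>The square root of the marginal; \<open>kron_id K A\<close> is the square root
    of the decoupled state.\<close>
  define A where "A = q * rdiag m (\<lambda>u. sqrt (l u)) * adj q"
  have W: "W \<in> carrier_mat N (m * K)" by (auto simp: W_def)
  have Wpi: "W * adj W * W = W"
  proof -
    have "W * adj W * W = (T * adj T * T) * adj U"
      by (simp add: W_def adj_mult mult_mat_assoc cancel_unitaries)
    then show ?thesis by (simp add: T_partial_isometry W_def)
  qed
  have R: "R = U * rdiag (m * K) (\<lambda>i. sqrt (p i)) * adj U"
  proof -
    have "R = U * adj (adj X * T)" by (simp add: R_def W_def adj_mult mult_mat_assoc)
    then show ?thesis unfolding adj_X_T by (simp add: adj_mult mult_mat_assoc)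
  qed
  have Rc: "R \<in> carrier_mat (m * K) (m * K)"
    unfolding R_def by (rule mult_carrier_mat[OF adj_carrier[OF W] X])
  have Ac: "A \<in> carrier_mat m m" using q by (auto simp: A_def)
  have l0: "l u \<ge> 0" if "u < m" for u
    using s_nonneg[of "u * K"] that K by simp
  \<comment> \<open>The marginal has trace \<open>1 / K\<close>; in the Cauchy-Schwarz estimate
    below this supplies the normalization of \<open>block_fidelity\<close>.\<close>
  have frobA: "frob A = 1 / real K"
  proof -
    have "adj A = A"
      unfolding A_def using q by (simp add: adj_mult mult_mat_assoc)
    then have "adj A * A = q * (rdiag m (\<lambda>u. sqrt (l u)) * (adj q * q) * rdiag m (\<lambda>u. sqrt (l u))) * adj q"
      by (simp only:) (use q in \<open>simp add: A_def mult_mat_assoc\<close>)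
    also have "\<dots> = q * (rdiag m (\<lambda>u. sqrt (l u)) * rdiag m (\<lambda>u. sqrt (l u))) * adj q"
      using q by (simp add: unitary_def)
    also have "rdiag m (\<lambda>u. sqrt (l u)) * rdiag m (\<lambda>u. sqrt (l u)) = rdiag m l"
      unfolding rdiag_mult by (rule rdiag_cong) (simp add: l0)
    finally have AA: "adj A * A = block_marginal K m (adj X * X)" by (simp only: marg)
    have "complex_of_real (frob A) = (\<Sum>u<m. (\<Sum>b<K. (adj X * X) $$ (u * K + b, u * K + b)) / of_nat K)"
      unfolding tr_adj_mult_self[symmetric] AA by (simp add: tr_def block_marginal_def)
    also have "\<dots> = tr (adj X * X) / of_nat K"
      by (simp add: tr_def sum_blocks sum_divide_distrib del: index_mult_mat(1))
    also have "\<dots> = of_real (1 / real K)" by (simp add: tr_adj_mult_self norm)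
    finally show ?thesis by (simp only: of_real_eq_iff)
  qed
  let ?f = "\<Sum>i<m * K. \<Sum>j<m * K. sqrt (p i) * sqrt (l (j div K)) * (cmod (x j i))\<^sup>2"
  \<comment> \<open>The trace of the product of the two square roots; the identity factor of
    \<open>kron_id K A\<close> keeps only the diagonals of the blocks of \<open>R\<close>.\<close>
  have "complex_of_real ?f = tr (R * kron_id K A)"
    unfolding R A_def kron_id_spectral(3)[OF q] using q U by (subst tr_mult_spectral) auto
  also have "\<dots> = (\<Sum>u<m. \<Sum>q<K. \<Sum>v<m. \<Sum>q'<K. if q' = q then R $$ (u * K + q, v * K + q) * A $$ (v, u) else 0)"
  proof -
    have "tr (R * kron_id K A) = (\<Sum>u<m. \<Sum>q<K. (R * kron_id K A) $$ (u * K + q, u * K + q))"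
      using Rc by (simp add: tr_def sum_blocks del: index_mult_mat(1))
    also have "\<dots> = (\<Sum>u<m. \<Sum>q<K. \<Sum>v<m. \<Sum>q'<K. R $$ (u * K + q, v * K + q') * kron_id K A $$ (v * K + q', u * K + q))"
      using Rc Ac by (intro sum.cong refl, subst index_mult_mat_sum) (auto simp: block_index_less sum_blocks)
    also have "\<dots> = (\<Sum>u<m. \<Sum>q<K. \<Sum>v<m. \<Sum>q'<K. if q' = q then R $$ (u * K + q, v * K + q) * A $$ (v, u) else 0)"
      using Ac by (intro sum.cong refl) auto
    finally show ?thesis .
  qed
  also have "\<dots> = (\<Sum>u<m. \<Sum>q<K. \<Sum>v<m. R $$ (u * K + q, v * K + q) * A $$ (v, u))" by simp
  also have "\<dots> = (\<Sum>u<m. \<Sum>v<m. block_trace K R u v * A $$ (v, u))"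
    unfolding block_trace_def sum_distrib_right by (rule sum.cong[OF refl], rule sum.swap)
  finally have f_eq: "complex_of_real ?f = (\<Sum>a\<in>{..<m} \<times> {..<m}. block_trace K R (fst a) (snd a) * A $$ (snd a, fst a))"
    by (simp add: sum.cartesian_product split_beta)
  have "?f\<^sup>2 = (cmod (complex_of_real ?f))\<^sup>2" by (simp only: norm_of_real power2_abs)
  also have "\<dots> \<le> (\<Sum>a\<in>{..<m} \<times> {..<m}. (cmod (block_trace K R (fst a) (snd a)))\<^sup>2) *
      (\<Sum>a\<in>{..<m} \<times> {..<m}. (cmod (A $$ (snd a, fst a)))\<^sup>2)"
    unfolding f_eq by (rule norm_sum_mult_le)
  also have "(\<Sum>a\<in>{..<m} \<times> {..<m}. (cmod (A $$ (snd a, fst a)))\<^sup>2) = frob A"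
    unfolding frob_def using Ac by (subst sum.swap) (simp add: sum.cartesian_product split_beta)
  also have "(\<Sum>a\<in>{..<m} \<times> {..<m}. (cmod (block_trace K R (fst a) (snd a)))\<^sup>2) * frob A = block_fidelity K m m R"
    by (simp add: frobA block_fidelity_def sum.cartesian_product split_beta)
  finally have "?f \<le> sqrt (block_fidelity K m m R)" by (rule real_le_rsqrt)
  then have "2 * (1 - sqrt (block_fidelity K m m R)) \<le> rel_entropy (adj X * X) (decoupled K (adj X * X))"
    using rel_entropy_ge by simp
  moreover have "block_fidelity K m m R \<le> 1"
  proof -
    have "block_fidelity K m m R \<le> frob R" by (rule block_fidelity_le[OF Rc K])
    also have "\<dots> \<le> frob X"
      unfolding R_def using W X by (intro frob_adj_partial_isometry_le Wpi) auto
    finally show ?thesis by (simp add: norm)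
  qed
  ultimately show ?thesis using that[OF W Wpi] by (simp add: R_def)
qed

section \<open>Kraus channels and the state of the code\<close>

lemma foldr_gram:
  assumes "\<forall>A\<in>set As. A \<in> carrier_mat dout din"
  shows "foldr (\<lambda>A M. adj A * A + M) As (0\<^sub>m din din)
    = mat din din (\<lambda>(i, j). \<Sum>A\<leftarrow>As. \<Sum>q<dout. cnj (A $$ (q, i)) * A $$ (q, j))"
  using assms
proof (induction As)
  case (Cons A As)
  then have A: "A \<in> carrier_mat dout din" by simp
  show ?case
    using Cons A by (intro eq_matI) (auto simp: index_mult_mat_sum simp del: index_mult_mat(1))
qed (auto intro!: eq_matI)

text \<open>In this entrywise form the contributions of a concatenated Kraus list simply add
  up.\<close>

lemma kraus_channel_iff:
  "kraus_channel As din dout \<longleftrightarrow> (\<forall>A\<in>set As. A \<in> carrier_mat dout din) \<and>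
    (\<forall>i<din. \<forall>j<din. (\<Sum>A\<leftarrow>As. \<Sum>q<dout. cnj (A $$ (q, i)) * A $$ (q, j)) = (if i = j then 1 else 0))"
  unfolding kraus_channel_def
  by (intro conj_cong refl) (simp add: foldr_gram mat_eq_iff)

text \<open>The Stinespring isometry of a channel, with the Kraus index as environment.\<close>

definition vstack :: "nat \<Rightarrow> nat \<Rightarrow> complex mat list \<Rightarrow> complex mat" where
  "vstack dout din As = mat (length As * dout) din (\<lambda>(i, a). (As ! (i div dout)) $$ (i mod dout, a))"

lemma vstack_dim [simp]: "dim_row (vstack dout din As) = length As * dout" "dim_col (vstack dout din As) = din"
  by (simp_all add: vstack_def)

lemma vstack_index [simp]:
  "e < length As \<Longrightarrow> q < dout \<Longrightarrow> a < din \<Longrightarrow> vstack dout din As $$ (e * dout + q, a) = (As ! e) $$ (q, a)"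
  by (simp add: vstack_def block_index_less)

lemma sum_list_nth: "(\<Sum>A\<leftarrow>As. f A) = (\<Sum>e<length As. f (As ! e))"
  by (simp add: sum_list_sum_nth lessThan_atLeast0)

lemma vstack_isometry:
  assumes "kraus_channel As din dout"
  shows "adj (vstack dout din As) * vstack dout din As = 1\<^sub>m din"
proof (rule eq_matI)
  fix i j assume "i < dim_row (1\<^sub>m din :: complex mat)" "j < dim_col (1\<^sub>m din :: complex mat)"
  then have ij: "i < din" "j < din" by auto
  have "(adj (vstack dout din As) * vstack dout din As) $$ (i, j)
    = (\<Sum>e<length As. \<Sum>q<dout. cnj ((As ! e) $$ (q, i)) * (As ! e) $$ (q, j))"
    using ij by (subst index_mult_mat_sum) (auto simp: sum_blocks block_index_less)
  also have "\<dots> = 1\<^sub>m din $$ (i, j)"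
    using assms ij by (simp add: kraus_channel_iff sum_list_nth)
  finally show "(adj (vstack dout din As) * vstack dout din As) $$ (i, j) = 1\<^sub>m din $$ (i, j)" .
qed auto

lemma ent_fidelity_kraus_comp:
  "ent_fidelity K (kraus_comp Bs As) = (\<Sum>B\<leftarrow>Bs. \<Sum>A\<leftarrow>As. (cmod (tr (B * A) / of_nat K))\<^sup>2)"
  unfolding ent_fidelity_def kraus_comp_def by (induction Bs) (simp_all add: o_def)

lemma kraus_comp_singleton: "kraus_comp As [V] = map (\<lambda>A. A * V) As"
  unfolding kraus_comp_def by (induction As) simp_all

definition code_state :: "complex mat \<Rightarrow> nat \<Rightarrow> complex mat list \<Rightarrow> complex mat" where
  "code_state V K Es = mat (dim_row V) (length Es * K)
     (\<lambda>(a, j). (Es ! (j div K) * V) $$ (a, j mod K) / of_real (sqrt (real K)))"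

section \<open>A single code with noise: its state, its entropy and its recoveries\<close>

locale noisy_code =
  fixes V :: "complex mat" and K d :: nat and Es :: "complex mat list"
  assumes K_pos: "K > 0" and code: "isometry V K d" and noise: "kraus_channel Es d d"
begin

abbreviation m :: nat where "m \<equiv> length Es"
abbreviation X :: "complex mat" where "X \<equiv> code_state V K Es"

lemma V: "dim_row V = d" "dim_col V = K" "adj V * V = 1\<^sub>m K"
  using code by (auto simp: isometry_def)

lemma Es: "u < m \<Longrightarrow> dim_row (Es ! u) = d" "u < m \<Longrightarrow> dim_col (Es ! u) = d"
  using noise nth_mem by (fastforce simp: kraus_channel_def)+

lemma X_carrier: "X \<in> carrier_mat d (m * K)"
  by (auto simp: code_state_def V)

lemma X_dim [simp]: "dim_row X = d" "dim_col X = m * K"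
  using X_carrier by auto

lemma X_index:
  "a < d \<Longrightarrow> u < m \<Longrightarrow> q < K \<Longrightarrow> X $$ (a, u * K + q) = (Es ! u * V) $$ (a, q) / of_real (sqrt (real K))"
  by (simp add: code_state_def V block_index_less)

lemma gram_X_index:
  assumes "u < m" "q < K" "v < m" "q' < K"
  shows "(adj X * X) $$ (u * K + q, v * K + q') = (adj (Es ! u * V) * (Es ! v * V)) $$ (q, q') / of_nat K"
proof -
  have K2: "complex_of_real (sqrt (real K)) * complex_of_real (sqrt (real K)) = of_nat K"
    by (simp flip: of_real_mult)
  have "(adj X * X) $$ (u * K + q, v * K + q')
     = (\<Sum>a<d. cnj ((Es ! u * V) $$ (a, q)) * (Es ! v * V) $$ (a, q') / of_nat K)"
    using assms by (subst index_mult_mat_sum)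
      (auto simp: block_index_less X_index K2 simp del: index_mult_mat(1) intro!: sum.cong)
  also have "\<dots> = (adj (Es ! u * V) * (Es ! v * V)) $$ (q, q') / of_nat K"
    using assms by (subst index_mult_mat_sum) (auto simp: V Es sum_divide_distrib simp del: index_mult_mat(1))
  finally show ?thesis .
qed

lemma V_cancel: "dim_row A = K \<Longrightarrow> adj V * (V * A) = A"
proof -
  assume "dim_row A = K"
  then have "adj V * (V * A) = 1\<^sub>m K * A" by (simp add: V flip: mult_mat_assoc)
  also have "\<dots> = A" using \<open>dim_row A = K\<close> by (intro left_mult_one_mat) auto
  finally show ?thesis .
qed

text \<open>Adding \<open>B_mat\<close> cancels the scalar terms and leaves the overlaps of the
  noisy code words; \<open>adj V * V = 1\<close> removes the projectors.\<close>

lemma Lambda_plus_B: "Lambda_mat V K Es + B_mat V K Es = adj X * X"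
proof (rule eq_mat_blocksI[of _ m K m])
  fix u q v q' assume *: "u < m" "q < K" "v < m" "q' < K"
  have "adj V * code_proj V * adj (Es ! u) * (Es ! v) * code_proj V * V = adj (Es ! u * V) * (Es ! v * V)"
    using * by (simp add: code_proj_def mult_mat_assoc V Es adj_mult V_cancel)
  then show "(Lambda_mat V K Es + B_mat V K Es) $$ (u * K + q, v * K + q') = (adj X * X) $$ (u * K + q, v * K + q')"
    using * by (simp add: Lambda_mat_def B_mat_def block_index_less gram_X_index diff_divide_distrib del: index_mult_mat(1))
qed (use X_carrier in \<open>auto simp: Lambda_mat_def B_mat_def\<close>)

text \<open>Cyclicity turns the trace against the code projector into a trace over the reference
  index.\<close>

lemma Lambda_eq_decoupled: "Lambda_mat V K Es = decoupled K (adj X * X)"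
proof (rule eq_mat_blocksI[of _ m K m])
  fix u q v q' assume *: "u < m" "q < K" "v < m" "q' < K"
  let ?M = "adj (Es ! u * V) * (Es ! v * V)"
  have "tr (code_proj V * adj (Es ! u) * (Es ! v) * code_proj V)
     = tr (V * (adj V * adj (Es ! u) * (Es ! v) * code_proj V))"
    using * by (simp add: code_proj_def mult_mat_assoc V Es)
  also have "\<dots> = tr ((adj V * adj (Es ! u) * (Es ! v) * code_proj V) * V)"
    using * by (intro tr_mult_comm) (auto simp: V Es code_proj_def)
  also have "(adj V * adj (Es ! u) * (Es ! v) * code_proj V) * V = ?M"
    using * by (simp add: code_proj_def mult_mat_assoc V Es adj_mult)
  also have "tr ?M = (\<Sum>b<K. ?M $$ (b, b))"
    by (simp add: tr_def V del: index_mult_mat(1))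
  finally have "aqec_lambda V K Es u v = (\<Sum>b<K. (adj X * X) $$ (u * K + b, v * K + b))"
    using * by (simp add: aqec_lambda_def gram_X_index sum_divide_distrib del: index_mult_mat(1))
  then show "Lambda_mat V K Es $$ (u * K + q, v * K + q') = decoupled K (adj X * X) $$ (u * K + q, v * K + q')"
    using * by (subst decoupled_index[of u m q K v q']) (auto simp: Lambda_mat_def block_index_less simp del: index_mult_mat(1))
qed (use X_carrier in \<open>auto simp: Lambda_mat_def\<close>)

lemma aqec_entropy_eq: "aqec_entropy V K Es = rel_entropy (adj X * X) (decoupled K (adj X * X))"
  unfolding aqec_entropy_def by (simp only: Lambda_plus_B) (simp only: Lambda_eq_decoupled)

text \<open>Noise and encoding both preserve norms. The blocks \<open>Es ! u * V\<close> stand side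
  by side in \<open>X\<close> and on top of each other in the stacked isometry, so the squared norms
  agree up to the factor \<open>K\<close>.\<close>

lemma frob_X: "frob X = 1"
proof -
  have "frob (vstack d d Es * V) = frob V"
    using vstack_isometry[OF noise] by (intro frob_isometry_mult) (auto simp: V)
  moreover have "complex_of_real (frob V) = of_real (real K)"
    unfolding tr_adj_mult_self[symmetric] V(3) by (simp add: tr_def)
  then have "frob V = real K" by (simp only: of_real_eq_iff)
  moreover have "frob (vstack d d Es * V) = (\<Sum>u<m. \<Sum>a<d. \<Sum>q<K. (cmod ((Es ! u * V) $$ (a, q)))\<^sup>2)"
  proof -
    have "(vstack d d Es * V) $$ (u * d + a, q) = (Es ! u * V) $$ (a, q)" if "u < m" "a < d" "q < K" for u a q
      using that by (subst (1 2) index_mult_mat_sum) (auto simp: V Es block_index_less)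
    then show ?thesis by (simp add: frob_def sum_blocks V del: index_mult_mat(1))
  qed
  ultimately have sum: "(\<Sum>u<m. \<Sum>a<d. \<Sum>q<K. (cmod ((Es ! u * V) $$ (a, q)))\<^sup>2) = real K" by simp
  have "frob X = (\<Sum>a<d. \<Sum>u<m. \<Sum>q<K. (cmod ((Es ! u * V) $$ (a, q)))\<^sup>2 / real K)"
    unfolding frob_def X_dim sum_blocks
    by (intro sum.cong refl) (simp add: X_index norm_divide power_divide del: index_mult_mat(1))
  also have "\<dots> = (\<Sum>u<m. \<Sum>a<d. \<Sum>q<K. (cmod ((Es ! u * V) $$ (a, q)))\<^sup>2) / real K"
    unfolding sum_divide_distrib by (rule sum.swap)
  finally show ?thesis using sum K_pos by simp
qed

lemma block_trace_mult_X:
  assumes "Y \<in> carrier_mat (r * K) d" "B \<in> carrier_mat K d" "e < r" "u < m"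
    and "\<And>q a. q < K \<Longrightarrow> a < d \<Longrightarrow> B $$ (q, a) = Y $$ (e * K + q, a)"
  shows "block_trace K (Y * X) e u = tr (B * (Es ! u * V)) / of_real (sqrt (real K))"
proof -
  have "block_trace K (Y * X) e u = (\<Sum>q<K. \<Sum>a<d. B $$ (q, a) * (Es ! u * V) $$ (a, q) / of_real (sqrt (real K)))"
    unfolding block_trace_def
  proof (rule sum.cong[OF refl])
    fix q assume "q \<in> {..<K}"
    then have q: "q < K" by simp
    have "(Y * X) $$ (e * K + q, u * K + q) = (\<Sum>a<d. Y $$ (e * K + q, a) * X $$ (a, u * K + q))"
      using q assms by (subst index_mult_mat_sum) (auto simp: block_index_less)
    also have "\<dots> = (\<Sum>a<d. B $$ (q, a) * (Es ! u * V) $$ (a, q) / of_real (sqrt (real K)))"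
      using q assms by (intro sum.cong refl) (simp add: X_index del: index_mult_mat(1))
    finally show "(Y * X) $$ (e * K + q, u * K + q) = (\<Sum>a<d. B $$ (q, a) * (Es ! u * V) $$ (a, q) / of_real (sqrt (real K)))" .
  qed
  also have "\<dots> = (\<Sum>q<K. (B * (Es ! u * V)) $$ (q, q)) / of_real (sqrt (real K))"
    using assms unfolding sum_divide_distrib
    by (intro sum.cong refl, subst index_mult_mat_sum) (auto simp: V Es sum_divide_distrib simp del: index_mult_mat(1))
  finally show ?thesis using assms by (simp add: tr_def del: index_mult_mat(1))
qed

text \<open>\<open>Y\<close> is any stack of blocks, so this serves recovery channels and the
  incomplete family given by \<open>adj W\<close> alike. One factor \<open>1 / K\<close> comes from
  \<open>code_state\<close> and one from \<open>block_fidelity\<close>.\<close>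

lemma block_fidelity_mult_X:
  assumes "Y \<in> carrier_mat (r * K) d" "\<And>e. e < r \<Longrightarrow> B e \<in> carrier_mat K d"
    and "\<And>e q a. e < r \<Longrightarrow> q < K \<Longrightarrow> a < d \<Longrightarrow> B e $$ (q, a) = Y $$ (e * K + q, a)"
  shows "block_fidelity K r m (Y * X) = (\<Sum>e<r. \<Sum>u<m. (cmod (tr (B e * (Es ! u * V)) / of_nat K))\<^sup>2)"
proof -
  have "(cmod (block_trace K (Y * X) e u))\<^sup>2 / real K = (cmod (tr (B e * (Es ! u * V)) / of_nat K))\<^sup>2"
    if "e < r" "u < m" for e u
    using block_trace_mult_X[OF assms(1) assms(2) that, of e] assms(3) that
    by (simp add: norm_divide power_divide power2_eq_square)
  then show ?thesis
    unfolding block_fidelity_def sum_divide_distrib by (intro sum.cong refl) auto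
qed

abbreviation fidelity :: "complex mat list \<Rightarrow> real" where
  "fidelity Rs \<equiv> ent_fidelity K (kraus_comp Rs (kraus_comp Es [V]))"

lemma fidelity_eq: "fidelity Rs = (\<Sum>B\<leftarrow>Rs. \<Sum>u<m. (cmod (tr (B * (Es ! u * V)) / of_nat K))\<^sup>2)"
  by (simp add: ent_fidelity_kraus_comp kraus_comp_singleton o_def sum_list_nth[of _ Es])

context
  fixes Rs :: "complex mat list"
  assumes R: "kraus_channel Rs d K"
begin

lemma recovered_carrier: "vstack K d Rs * X \<in> carrier_mat (length Rs * K) (m * K)"
  by auto

lemma frob_recovered: "frob (vstack K d Rs * X) = 1"
  using frob_isometry_mult[of "vstack K d Rs" X] vstack_isometry[OF R] frob_X by simp

lemma fidelity_eq_block_fidelity: "fidelity Rs = block_fidelity K (length Rs) m (vstack K d Rs * X)"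
proof -
  have "Rs ! e \<in> carrier_mat K d" if "e < length Rs" for e
    using R that by (auto simp: kraus_channel_def)
  then show ?thesis
    by (subst block_fidelity_mult_X[where B="\<lambda>e. Rs ! e"]) (auto simp: fidelity_eq sum_list_nth[of _ Rs])
qed

lemma fidelity_le_1: "fidelity Rs \<le> 1"
  using block_fidelity_le[OF recovered_carrier K_pos] frob_recovered fidelity_eq_block_fidelity by simp

text \<open>The stacked recovery is an isometry: it leaves the state and hence the entropy
  unchanged, while the block fidelity becomes the entanglement fidelity.\<close>

lemma aqec_entropy_le:
  assumes "1 - fidelity Rs \<le> \<epsilon>" "\<epsilon> > 0" "0 < \<theta>" "\<theta> < 1"
  defines "\<eta> \<equiv> real K powr \<theta> * \<epsilon> powr ((1 - \<theta>) / 2)"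
  shows "aqec_entropy V K Es \<le> (2 * \<eta> + \<eta>\<^sup>2) / \<theta>"
proof -
  have "adj (vstack K d Rs * X) * (vstack K d Rs * X) = adj X * X"
    using vstack_isometry[OF R] by (subst adj_mult_adj_mult_self) (auto simp: right_mult_one_mat[of _ "m * K" d])
  then show ?thesis
    using rel_entropy_le_of_block_fidelity[OF recovered_carrier K_pos frob_recovered, of \<epsilon> \<theta>] assms
    by (simp add: fidelity_eq_block_fidelity aqec_entropy_eq)
qed

end

text \<open>The Gram sum of the blocks \<open>B e\<close> of \<open>adj W\<close> is the projection
  \<open>P\<close>, possibly less than the identity. Completing the family adds nonnegative terms to
  the fidelity, so the bound for \<open>W\<close> survives.\<close>

lemma recovery_exists:
  obtains Rs where "kraus_channel Rs d K" "2 * (1 - sqrt (fidelity Rs)) \<le> aqec_entropy V K Es"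
proof -
  obtain W where W: "W \<in> carrier_mat d (m * K)" and pi: "W * adj W * W = W"
    and ent: "2 * (1 - sqrt (block_fidelity K m m (adj W * X))) \<le> aqec_entropy V K Es"
    using partial_isometry_recovery[OF X_carrier K_pos frob_X] aqec_entropy_eq by metis
  define P where "P = W * adj W"
  define D where "D = 1\<^sub>m d - P"
  have P: "P \<in> carrier_mat d d" unfolding P_def by (rule mult_carrier_mat[OF W adj_carrier[OF W]])
  have "adj P = P" using W by (simp add: P_def adj_mult)
  have PP: "P * P = P"
    using pi W by (simp add: P_def flip: mult_mat_assoc)
  have D: "D \<in> carrier_mat d d" using P by (auto simp: D_def)
  have "adj D = D"
  proof -
    have "adj D = 1\<^sub>m d - adj P" unfolding D_def using P by (intro eq_matI) auto
    then show ?thesis by (simp add: \<open>adj P = P\<close> D_def)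
  qed
  have "D * D = D - P * D"
    using P D by (subst D_def, subst diff_mult_mat) (auto simp: D_def)
  also have "P * D = P - P" using P by (simp add: D_def mult_diff_mat PP)
  finally have DD: "adj D * D = D" using P D by (intro eq_matI) (auto simp: \<open>adj D = D\<close> simp del: index_mult_mat(1))
  define B where "B e = mat K d (\<lambda>(q, a). adj W $$ (e * K + q, a))" for e
  \<comment> \<open>These operators complete \<open>W\<^sup>\<dagger>\<close> to a trace-preserving map.\<close>
  define C where "C k = mat K d (\<lambda>(q, a). if q = 0 then D $$ (k, a) else 0)" for k
  define Rs where "Rs = map B [0..<m] @ map C [0..<d]"
  have "kraus_channel Rs d K"
    unfolding kraus_channel_iff
  proof (intro conjI allI impI)
    show "\<forall>A\<in>set Rs. A \<in> carrier_mat K d" by (auto simp: Rs_def B_def C_def)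
    fix i j assume ij: "i < d" "j < d"
    have "(\<Sum>e<m. \<Sum>q<K. cnj (B e $$ (q, i)) * B e $$ (q, j)) = P $$ (i, j)"
    proof -
      have "P $$ (i, j) = (\<Sum>k<m * K. W $$ (i, k) * cnj (W $$ (j, k)))"
        using ij W unfolding P_def by (subst index_mult_mat_sum) auto
      also have "\<dots> = (\<Sum>e<m. \<Sum>q<K. cnj (B e $$ (q, i)) * B e $$ (q, j))"
        unfolding sum_blocks using ij W by (intro sum.cong refl) (auto simp: B_def block_index_less)
      finally show ?thesis by (rule sym)
    qed
    \<comment> \<open>Only row 0 contributes, and it exists because \<open>K\<close> is
      positive.\<close>
    moreover have "(\<Sum>k<d. \<Sum>q<K. cnj (C k $$ (q, i)) * C k $$ (q, j)) = (adj D * D) $$ (i, j)"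
    proof -
      have "(\<Sum>k<d. \<Sum>q<K. cnj (C k $$ (q, i)) * C k $$ (q, j))
        = (\<Sum>k<d. \<Sum>q<K. if q = 0 then cnj (D $$ (k, i)) * D $$ (k, j) else 0)"
        using ij by (intro sum.cong refl) (auto simp: C_def)
      then show ?thesis using ij D K_pos by (simp add: index_mult_mat_sum del: index_mult_mat(1))
    qed
    moreover have "(\<Sum>A\<leftarrow>Rs. \<Sum>q<K. cnj (A $$ (q, i)) * A $$ (q, j))
      = (\<Sum>e<m. \<Sum>q<K. cnj (B e $$ (q, i)) * B e $$ (q, j)) + (\<Sum>k<d. \<Sum>q<K. cnj (C k $$ (q, i)) * C k $$ (q, j))"
      unfolding Rs_def by (simp add: sum_list_nth)
    ultimately show "(\<Sum>A\<leftarrow>Rs. \<Sum>q<K. cnj (A $$ (q, i)) * A $$ (q, j)) = (if i = j then 1 else 0)"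
      using ij P unfolding DD by (simp add: D_def)
  qed
  moreover have "block_fidelity K m m (adj W * X) \<le> fidelity Rs"
  proof -
    have "block_fidelity K m m (adj W * X) = (\<Sum>e<m. \<Sum>u<m. (cmod (tr (B e * (Es ! u * V)) / of_nat K))\<^sup>2)"
      using W by (intro block_fidelity_mult_X) (auto simp: B_def)
    also have "\<dots> \<le> \<dots> + (\<Sum>k<d. \<Sum>u<m. (cmod (tr (C k * (Es ! u * V)) / of_nat K))\<^sup>2)"
      by (simp add: sum_nonneg)
    also have "\<dots> = fidelity Rs"
      unfolding fidelity_eq Rs_def by (simp add: sum_list_nth)
    finally show ?thesis .
  qed
  then have "2 * (1 - sqrt (fidelity Rs)) \<le> 2 * (1 - sqrt (block_fidelity K m m (adj W * X)))" by simp
  ultimately show ?thesis using ent that order_trans by blast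
qed

text \<open>Since fidelities are at most 1, the recovery bound has a nonnegative left side; this
  takes the place of Klein's inequality.\<close>

lemma aqec_entropy_nonneg: "aqec_entropy V K Es \<ge> 0"
proof -
  obtain Rs where Rs: "kraus_channel Rs d K" and le: "2 * (1 - sqrt (fidelity Rs)) \<le> aqec_entropy V K Es"
    by (rule recovery_exists)
  have "0 \<le> 2 * (1 - sqrt (fidelity Rs))" using fidelity_le_1[OF Rs] by simp
  also note le
  finally show ?thesis .
qed

end

section \<open>Families of codes\<close>

theorem theorem1:
  fixes d K :: "nat \<Rightarrow> nat" and V :: "nat \<Rightarrow> complex mat" and E :: "nat \<Rightarrow> complex mat list"
  assumes K_pos: "\<And>n. K n \<ge> 1"
    and code: "\<And>n. isometry (V n) (K n) (d n)"
    and noise: "\<And>n. kraus_channel (E n) (d n) (d n)"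
  defines "S \<equiv> \<lambda>n. aqec_entropy (V n) (K n) (E n)"
  shows
    "((S \<longlonglongrightarrow> 0) \<longrightarrow>
        (\<exists>R. (\<forall>n. kraus_channel (R n) (d n) (K n)) \<and>
             (\<lambda>n. ent_fidelity (K n) (kraus_comp (R n) (kraus_comp (E n) [V n]))) \<longlonglongrightarrow> 1))
   \<and> ((\<exists>C. \<forall>n. K n \<le> C) \<and> \<not> (S \<longlonglongrightarrow> 0) \<longrightarrow>
        (\<forall>R. (\<forall>n. kraus_channel (R n) (d n) (K n)) \<longrightarrow>
             \<not> ((\<lambda>n. ent_fidelity (K n) (kraus_comp (R n) (kraus_comp (E n) [V n]))) \<longlonglongrightarrow> 1)))
   \<and> (filterlim K at_top sequentially \<and> \<not> ((\<lambda>n. S n / ln (real (K n))) \<longlonglongrightarrow> 0) \<longrightarrow>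
        (\<forall>R. (\<forall>n. kraus_channel (R n) (d n) (K n)) \<longrightarrow>
             \<not> ((\<lambda>n. ent_fidelity (K n) (kraus_comp (R n) (kraus_comp (E n) [V n]))) \<longlonglongrightarrow> 1)))"
proof -
  let ?F = "\<lambda>R n. ent_fidelity (K n) (kraus_comp (R n) (kraus_comp (E n) [V n]))"
  have nc: "noisy_code (V n) (K n) (d n) (E n)" for n
    using K_pos[of n] code noise by (simp add: noisy_code_def)
  have S_nonneg: "S n \<ge> 0" for n
    unfolding S_def by (rule noisy_code.aqec_entropy_nonneg[OF nc])
  have part1: "\<exists>R. (\<forall>n. kraus_channel (R n) (d n) (K n)) \<and> ?F R \<longlonglongrightarrow> 1" if S0: "S \<longlonglongrightarrow> 0"
  proof -
    have "\<exists>Rs. kraus_channel Rs (d n) (K n) \<and>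
        2 * (1 - sqrt (ent_fidelity (K n) (kraus_comp Rs (kraus_comp (E n) [V n])))) \<le> S n" for n
      using noisy_code.recovery_exists[OF nc[of n]] unfolding S_def by metis
    then obtain R where R: "\<And>n. kraus_channel (R n) (d n) (K n)" "\<And>n. 2 * (1 - sqrt (?F R n)) \<le> S n"
      by metis
    have "(\<lambda>n. sqrt (?F R n)) \<longlonglongrightarrow> 1"
    proof (rule tendsto_sandwich)
      show "(\<lambda>n. 1 - S n / 2) \<longlonglongrightarrow> 1" using S0 by (auto intro!: tendsto_eq_intros)
      show "\<forall>\<^sub>F n in sequentially. 1 - S n / 2 \<le> sqrt (?F R n)" using R(2) by (intro always_eventually) (smt (verit) field_sum_of_halves)
      show "\<forall>\<^sub>F n in sequentially. sqrt (?F R n) \<le> 1"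
        using noisy_code.fidelity_le_1[OF nc R(1)] by (intro always_eventually) simp
    qed auto
    then have "(\<lambda>n. (sqrt (?F R n))\<^sup>2) \<longlonglongrightarrow> 1\<^sup>2" by (rule tendsto_power)
    moreover have "?F R n \<ge> 0" for n
      unfolding ent_fidelity_def by (intro sum_list_nonneg) auto
    ultimately show ?thesis using R(1) by auto
  qed
  \<comment> \<open>One sequence \<epsilon> serves all \<theta> at once, because the case of
    unbounded dimension lets \<theta> depend on \<open>n\<close>.\<close>
  have bound: "\<exists>\<epsilon>. (\<forall>n. \<epsilon> n > 0) \<and> \<epsilon> \<longlonglongrightarrow> 0 \<and> (\<forall>n \<theta>. 0 < \<theta> \<longrightarrow> \<theta> < 1 \<longrightarrow>
      S n \<le> (2 * (real (K n) powr \<theta> * \<epsilon> n powr ((1 - \<theta>) / 2)) + (real (K n) powr \<theta> * \<epsilon> n powr ((1 - \<theta>) / 2))\<^sup>2) / \<theta>)"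
    if R: "\<And>n. kraus_channel (R n) (d n) (K n)" and F: "?F R \<longlonglongrightarrow> 1" for R
  proof (intro exI conjI allI impI)
    \<comment> \<open>The vanishing summand keeps \<epsilon> positive even where the fidelity is
      1.\<close>
    let ?\<epsilon> = "\<lambda>n. 1 - ?F R n + inverse (real (Suc n))"
    have F1: "?F R n \<le> 1" for n by (rule noisy_code.fidelity_le_1[OF nc R])
    show pos: "?\<epsilon> n > 0" for n using F1[of n] by (simp add: add_nonneg_pos)
    show "?\<epsilon> \<longlonglongrightarrow> 0"
      using tendsto_add[OF tendsto_diff[OF tendsto_const F] LIMSEQ_inverse_real_of_nat, of 1] by simp
    show "S n \<le> (2 * (real (K n) powr \<theta> * ?\<epsilon> n powr ((1 - \<theta>) / 2)) + (real (K n) powr \<theta> * ?\<epsilon> n powr ((1 - \<theta>) / 2))\<^sup>2) / \<theta>"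
      if "0 < \<theta>" "\<theta> < 1" for n \<theta>
      unfolding S_def by (rule noisy_code.aqec_entropy_le[OF nc R _ pos that]) simp
  qed
  have part2: "S \<longlonglongrightarrow> 0" if C: "\<And>n. K n \<le> C" and R: "\<And>n. kraus_channel (R n) (d n) (K n)" "?F R \<longlonglongrightarrow> 1" for C R
  proof -
    obtain \<epsilon> where e: "\<And>n. \<epsilon> n > 0" "\<epsilon> \<longlonglongrightarrow> 0" "\<And>n \<theta>. 0 < \<theta> \<Longrightarrow> \<theta> < 1 \<Longrightarrow>
      S n \<le> (2 * (real (K n) powr \<theta> * \<epsilon> n powr ((1 - \<theta>) / 2)) + (real (K n) powr \<theta> * \<epsilon> n powr ((1 - \<theta>) / 2))\<^sup>2) / \<theta>"
      using bound[OF R] by metis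
    \<comment> \<open>For \<open>\<theta> = 1/2\<close> the exponent
      \<open>(1 - \<theta>) / 2\<close> is \<open>1/4\<close>; the bound \<open>C\<close> replaces
      \<open>K n\<close>.\<close>
    define \<eta> where "\<eta> n = real C powr (1/2) * \<epsilon> n powr (1/4)" for n
    have le: "S n \<le> 2 * (2 * \<eta> n + (\<eta> n)\<^sup>2)" for n
    proof -
      have "real (K n) powr (1/2) * \<epsilon> n powr ((1 - 1/2) / 2) \<le> \<eta> n"
        unfolding \<eta>_def using C[of n] by (intro mult_mono powr_mono2) auto
      then have "S n \<le> (2 * \<eta> n + (\<eta> n)\<^sup>2) / (1/2)"
        by (intro order_trans[OF e(3)[of "1/2" n]] divide_right_mono add_mono mult_left_mono power_mono) auto
      then show ?thesis by simp
    qed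
    have "\<eta> \<longlonglongrightarrow> real C powr (1/2) * 0"
      unfolding \<eta>_def using tendsto_powr'[OF e(2) tendsto_const, of "1/4"] e(1)
      by (intro tendsto_mult tendsto_const) (auto simp: less_imp_le)
    then have "\<eta> \<longlonglongrightarrow> 0" by simp
    then have "(\<lambda>n. 2 * (2 * \<eta> n + (\<eta> n)\<^sup>2)) \<longlonglongrightarrow> 2 * (2 * 0 + 0\<^sup>2)"
      by (intro tendsto_intros)
    then have lim: "(\<lambda>n. 2 * (2 * \<eta> n + (\<eta> n)\<^sup>2)) \<longlonglongrightarrow> 0" by simp
    show ?thesis
      by (rule tendsto_sandwich[OF always_eventually always_eventually tendsto_const lim]) (intro allI S_nonneg le)+
  qed
  have part3: "(\<lambda>n. S n / ln (real (K n))) \<longlonglongrightarrow> 0"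
    if K: "filterlim K at_top sequentially" and R: "\<And>n. kraus_channel (R n) (d n) (K n)" "?F R \<longlonglongrightarrow> 1" for R
  proof -
    obtain \<epsilon> where e: "\<And>n. \<epsilon> n > 0" "\<epsilon> \<longlonglongrightarrow> 0" "\<And>n \<theta>. 0 < \<theta> \<Longrightarrow> \<theta> < 1 \<Longrightarrow>
      S n \<le> (2 * (real (K n) powr \<theta> * \<epsilon> n powr ((1 - \<theta>) / 2)) + (real (K n) powr \<theta> * \<epsilon> n powr ((1 - \<theta>) / 2))\<^sup>2) / \<theta>"
      using bound[OF R] by metis
    \<comment> \<open>\<open>exp 1\<close> is the value of \<open>K n powr \<theta>\<close> at
      \<open>\<theta> = 1 / ln (K n)\<close>. The exponent \<open>1/4\<close> is at most
      \<open>(1 - \<theta>) / 2\<close> once \<open>\<theta> \<le> 1/2\<close>, which suffices when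
      \<open>\<epsilon> n < 1\<close>.\<close>
    define \<eta> where "\<eta> n = exp 1 * \<epsilon> n powr (1/4)" for n
    have "filterlim (\<lambda>n. ln (real (K n))) at_top sequentially"
      by (rule filterlim_compose[OF ln_at_top filterlim_compose[OF filterlim_real_sequentially K]])
    \<comment> \<open>Logarithms of at least 2 give \<open>\<theta> \<le> 1/2\<close>.\<close>
    then have lnK: "\<forall>\<^sub>F n in sequentially. ln (real (K n)) \<ge> 2" by (simp add: filterlim_at_top)
    have e1: "\<forall>\<^sub>F n in sequentially. \<epsilon> n < 1" using order_tendstoD(2)[OF e(2), of 1] by simp
    have le: "\<forall>\<^sub>F n in sequentially. S n / ln (real (K n)) \<le> 2 * \<eta> n + (\<eta> n)\<^sup>2"
      using lnK e1
    proof eventually_elim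
      case (elim n)
      define \<theta> where "\<theta> = 1 / ln (real (K n))"
      have th: "0 < \<theta>" "\<theta> \<le> 1/2" using elim(1) by (auto simp: \<theta>_def field_simps)
      have "real (K n) powr \<theta> = exp 1"
        using elim(1) by (cases "K n = 1") (use K_pos[of n] in \<open>auto simp: powr_def \<theta>_def\<close>)
      moreover have "\<epsilon> n powr ((1 - \<theta>) / 2) \<le> \<epsilon> n powr (1/4)"
        using e(1)[of n] elim(2) th by (intro powr_mono') auto
      ultimately have "real (K n) powr \<theta> * \<epsilon> n powr ((1 - \<theta>) / 2) \<le> \<eta> n"
        by (simp add: \<eta>_def)
      then have "S n \<le> (2 * \<eta> n + (\<eta> n)\<^sup>2) / \<theta>"
        using th by (intro order_trans[OF e(3)[of \<theta> n]] divide_right_mono add_mono mult_left_mono power_mono) auto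
      \<comment> \<open>Division by \<open>ln (K n)\<close> is multiplication by \<theta>, which
        cancels the \<open>1 / \<theta>\<close> of the bound.\<close>
      then show ?case using elim(1) by (simp add: \<theta>_def divide_le_eq)
    qed
    have "\<eta> \<longlonglongrightarrow> exp 1 * 0"
      unfolding \<eta>_def using tendsto_powr'[OF e(2) tendsto_const, of "1/4"] e(1)
      by (intro tendsto_mult tendsto_const) (auto simp: less_imp_le)
    then have "\<eta> \<longlonglongrightarrow> 0" by simp
    then have "(\<lambda>n. 2 * \<eta> n + (\<eta> n)\<^sup>2) \<longlonglongrightarrow> 2 * 0 + 0\<^sup>2" by (intro tendsto_intros)
    then have lim: "(\<lambda>n. 2 * \<eta> n + (\<eta> n)\<^sup>2) \<longlonglongrightarrow> 0" by simp
    have "\<forall>\<^sub>F n in sequentially. 0 \<le> S n / ln (real (K n))"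
      using lnK by eventually_elim (use S_nonneg in auto)
    then show ?thesis by (rule tendsto_sandwich[OF _ le tendsto_const lim])
  qed
  show ?thesis
  proof (intro conjI impI allI notI)
    show "\<exists>R. (\<forall>n. kraus_channel (R n) (d n) (K n)) \<and> ?F R \<longlonglongrightarrow> 1" if "S \<longlonglongrightarrow> 0"
      using that by (rule part1)
    show False if "(\<exists>C. \<forall>n. K n \<le> C) \<and> \<not> S \<longlonglongrightarrow> 0" "\<forall>n. kraus_channel (R n) (d n) (K n)" "?F R \<longlonglongrightarrow> 1" for R
      using that part2[of _ R] by blast
    show False if "filterlim K at_top sequentially \<and> \<not> (\<lambda>n. S n / ln (real (K n))) \<longlonglongrightarrow> 0"
      "\<forall>n. kraus_channel (R n) (d n) (K n)" "?F R \<longlonglongrightarrow> 1" for R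
      using that part3[of R] by blast
  qed
qed

end
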